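(* Let $\mu\in\mathcal P_4(\mathbb R^{d_x})$, $\nu\in\mathcal P_4(\mathbb R^{d_y})$, and let $(\varepsilon_k)_{k\in\mathbb N}$ be a sequence of positive numbers with $\varepsilon_k\searrow\varepsilon\ge0$. For each $k\in\mathbb N$, let $\pi_k\in\Pi(\mu,\nu)$ be an optimal coupling for $\mathsf S_{\varepsilon_k}(\mu,\nu)$. Then there exists $\pi\in\Pi(\mu,\nu)$ such that $\pi_k\to\pi$ weakly as $k\to\infty$ along a subsequence, and $\pi$ is optimal for $\mathsf S_\varepsilon(\mu,\nu)$.
   Context: $\mathcal P_4(\mathbb R^d)$ is the set of Borel probability measures on $\mathbb R^d$ with finite fourth absolute moment. $\Pi(\mu,\nu)$ is the set of couplings of $\mu$ and $\nu$. $\mathsf D_{\mathsf{KL}}(\alpha\|\beta)=\int\log(d\alpha/d\beta)\,d\alpha$ if $\alpha\ll\beta$ and $+\infty$ otherwise. For $\varepsilon>0$, $$\mathsf S_\varepsilon(\mu,\nu):=\inf_{\pi\in\Pi(\mu,\nu)}\iint\big|\|x-x'\|^2-\|y-y'\|^2\big|^2\,d\pi\otimes\pi(x,y,x',y')+\varepsilon\,\mathsf D_{\mathsf{KL}}(\pi\|\mu\otimes\nu),$$ and $\mathsf S_0(\mu,\nu)$ is the same problem without the KL term, i.e. $\mathsf S_0(\mu,\nu)=\mathsf D(\mu,\nu)^2$ is the squared $(2,2)$-Gromov-Wasserstein distance. A coupling is optimal for $\mathsf S_\varepsilon(\mu,\nu)$ if it attains the infimum. *)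

theory Defs
  imports "HOL-Probability.Probability"
begin

definition P4 :: "'a::euclidean_space measure set" where
  "P4 = {\<mu>. sets \<mu> = sets borel \<and> prob_space \<mu> \<and> (\<integral>\<^sup>+ x. ennreal (norm x ^ 4) \<partial>\<mu>) < \<infinity>}"

definition couplings ::
  "'a::euclidean_space measure \<Rightarrow> 'b::euclidean_space measure \<Rightarrow> ('a \<times> 'b) measure set" where
  "couplings \<mu> \<nu> = {\<pi>. sets \<pi> = sets borel \<and> prob_space \<pi> \<and>
     distr \<pi> borel fst = \<mu> \<and> distr \<pi> borel snd = \<nu>}"

text \<open>
  The library's \<^const>\<open>KL_divergence\<close> is a real-valued Bochner integral, so it cannot take the
  value \<open>\<infinity>\<close>.  Here the log-density is integrated in the extended reals, as the integral of
  its positive part minus that of its negative part; for probability measures the latter is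
  finite.  In \<open>entropy_density b M N\<close> the density is that of \<open>N\<close> with respect to \<open>M\<close>.
\<close>

definition D_KL :: "'a measure \<Rightarrow> 'a measure \<Rightarrow> ereal" where
  "D_KL \<alpha> \<beta> =
     (if absolutely_continuous \<beta> \<alpha>
      then enn2ereal (\<integral>\<^sup>+ z. ennreal (entropy_density (exp 1) \<beta> \<alpha> z) \<partial>\<alpha>)
         - enn2ereal (\<integral>\<^sup>+ z. ennreal (- entropy_density (exp 1) \<beta> \<alpha> z) \<partial>\<alpha>)
      else \<infinity>)"

lemma D_KL_eq_KL_divergence:
  assumes "absolutely_continuous \<beta> \<alpha>" "integrable \<alpha> (entropy_density (exp 1) \<beta> \<alpha>)"
  shows "D_KL \<alpha> \<beta> = ereal (KL_divergence (exp 1) \<beta> \<alpha>)"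
proof -
  let ?f = "entropy_density (exp 1) \<beta> \<alpha>"
  have p: "(\<integral>\<^sup>+ z. ennreal (?f z) \<partial>\<alpha>) \<noteq> \<infinity>"
    and n: "(\<integral>\<^sup>+ z. ennreal (- ?f z) \<partial>\<alpha>) \<noteq> \<infinity>"
    using assms(2) by (auto simp: real_integrable_def)
  have "enn2ereal a - enn2ereal b = ereal (enn2real a - enn2real b)"
    if "a \<noteq> \<infinity>" "b \<noteq> \<infinity>" for a b :: ennreal
    using that by (cases a; cases b) (auto simp: enn2ereal_ennreal)
  from this[OF p n] show ?thesis
    using assms by (simp add: D_KL_def KL_divergence_def real_lebesgue_integral_def)
qed

definition gw_distortion :: "('a::euclidean_space \<times> 'b::euclidean_space) measure \<Rightarrow> ennreal" where
  "gw_distortion \<pi> = (\<integral>\<^sup>+ ((x, y), (x', y')).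
     ennreal (\<bar>(norm (x - x'))\<^sup>2 - (norm (y - y'))\<^sup>2\<bar>\<^sup>2) \<partial>(\<pi> \<Otimes>\<^sub>M \<pi>))"

definition S_objective ::
  "real \<Rightarrow> 'a::euclidean_space measure \<Rightarrow> 'b::euclidean_space measure \<Rightarrow> ('a \<times> 'b) measure \<Rightarrow> ereal" where
  "S_objective \<epsilon> \<mu> \<nu> \<pi> = enn2ereal (gw_distortion \<pi>) +
     (if \<epsilon> = 0 then 0 else ereal \<epsilon> * D_KL \<pi> (\<mu> \<Otimes>\<^sub>M \<nu>))"

definition S :: "real \<Rightarrow> 'a::euclidean_space measure \<Rightarrow> 'b::euclidean_space measure \<Rightarrow> ereal" where
  "S \<epsilon> \<mu> \<nu> = (INF \<pi>\<in>couplings \<mu> \<nu>. S_objective \<epsilon> \<mu> \<nu> \<pi>)"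

definition optimal_coupling ::
  "real \<Rightarrow> 'a::euclidean_space measure \<Rightarrow> 'b::euclidean_space measure \<Rightarrow> ('a \<times> 'b) measure \<Rightarrow> bool" where
  "optimal_coupling \<epsilon> \<mu> \<nu> \<pi> \<longleftrightarrow> \<pi> \<in> couplings \<mu> \<nu> \<and> S_objective \<epsilon> \<mu> \<nu> \<pi> = S \<epsilon> \<mu> \<nu>"

text \<open>The library's \<^const>\<open>weak_conv_m\<close> covers only measures on the real line.\<close>

definition weakly_converges :: "(nat \<Rightarrow> 'a::topological_space measure) \<Rightarrow> 'a measure \<Rightarrow> bool" where
  "weakly_converges M_seq M \<longleftrightarrow>
     (\<forall>f :: 'a \<Rightarrow> real. continuous_on UNIV f \<longrightarrow> bounded (range f) \<longrightarrow>
        (\<lambda>n. \<integral>x. f x \<partial>M_seq n) \<longlonglongrightarrow> (\<integral>x. f x \<partial>M))"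

end

theory Submission
  imports Defs
begin

text \<open>
  The theorem is an instance of the direct method of the calculus of variations.

  \<^item> Compactness: all couplings of \<open>\<mu>\<close> and \<open>\<nu>\<close> share their marginals, hence form a tight set
    (\<open>couplings_tight\<close>), and a tight sequence of laws on a Euclidean space has a subsequence whose
    members are the laws of random variables that converge pointwise
    (\<open>tight_imp_convergent_representation\<close>, Prokhorov's and Skorokhod's theorems in one).
    This reduces to Helly's selection theorem and Skorokhod's theorem on the real line: a continuous
    surjection of the line onto the space (\<open>space_filling_curve\<close>) has a Borel section, so the laws
    can be lifted to the line and pushed back after passing to the limit.

  \<^item> The distortion is continuous along such representations (\<open>gw_distortion_limit\<close>): the cost lies
    between \<open>0\<close> and a sum of fourth powers whose integral is the same for all couplings, so Fatou's
    lemma applies to the cost and to its difference from this bound.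

  \<^item> The divergence \<open>D_KL \<alpha> \<beta>\<close> is lower semicontinuous in \<open>\<alpha>\<close> (\<open>D_KL_weak_limit_le\<close>), because for
    probability measures and \<open>C \<ge> 0\<close> the inequality \<open>D_KL \<alpha> \<beta> \<le> C\<close> holds iff \<open>\<integral> f d\<alpha> \<le> C + \<integral> (exp f - 1) d\<beta>\<close> for all bounded continuous \<open>f\<close>
    (\<open>integral_le_D_KL\<close>, \<open>D_KL_le_if_duality_bound\<close>).

  Let \<open>\<pi>\<close> be the limit and \<open>\<rho>\<close> a coupling of finite divergence.  The divergence is nonnegative and
  \<open>\<epsilon> \<le> \<epsilon>\<^sub>k\<close>, so the optimality of \<open>\<pi>\<^sub>k\<close> bounds the \<open>\<epsilon>\<close>-objective of \<open>\<pi>\<^sub>k\<close> by the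
  \<open>\<epsilon>\<^sub>k\<close>-objective of \<open>\<rho>\<close>, and the limit \<open>k \<rightarrow> \<infinity>\<close> compares \<open>\<pi>\<close> with \<open>\<rho>\<close>.  A competitor of
  infinite divergence matters only if \<open>\<epsilon> = 0\<close>; it is then approximated by couplings of finite
  divergence, which are products on the blocks of a finite partition (\<open>finite_D_KL_dense\<close>).
\<close>

section \<open>A space-filling curve\<close>

text \<open>
  Schoenberg's construction.  A continuous function of period \<open>2\<close> that is \<open>0\<close> on \<open>[0, 1/3]\<close> and \<open>1\<close>
  on \<open>[2/3, 1]\<close>; applied to \<open>3\<^sup>m t\<close> it reads off half the \<open>m\<close>-th ternary digit, which is \<open>0\<close> or
  \<open>2\<close>, of a point \<open>t\<close> of the Cantor set.
\<close>

definition bump :: "real \<Rightarrow> real" where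
  "bump t = max 0 (min 1 (1/2 - cos (pi * t)))"

lemma bump_bounds: "0 \<le> bump t" "bump t \<le> 1"
  by (auto simp: bump_def)

lemma continuous_bump: "continuous_on A bump"
  unfolding bump_def by (intro continuous_intros)

lemma bump_periodic: "bump (2 * real k + t) = bump t"
proof -
  have "pi * (2 * real k + t) = 2 * real k * pi + pi * t" by (simp add: algebra_simps)
  then have "cos (pi * (2 * real k + t)) = cos (pi * t)"
    by (simp add: cos_add)
  then show ?thesis by (simp add: bump_def)
qed

lemma bump_eq_0: assumes "0 \<le> t" "t \<le> 1/3" shows "bump t = 0"
proof -
  have "cos (pi / 3) \<le> cos (pi * t)"
    using assms mult_left_mono[of t "1/3" pi] by (intro cos_monotone_0_pi_le) auto
  then show ?thesis by (simp add: bump_def cos_60)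
qed

lemma bump_eq_1: assumes "2/3 \<le> t" "t \<le> 1" shows "bump t = 1"
proof -
  have "cos (pi * t) \<le> cos (2 * pi / 3)"
    using assms mult_left_mono[of "2/3" t pi] mult_left_mono[of t 1 pi] by (intro cos_monotone_0_pi_le) auto
  then show ?thesis by (simp add: bump_def cos_120)
qed

text \<open>
  The point of the Cantor set whose ternary digits are \<open>2\<close> where \<open>b\<close> holds and \<open>0\<close> elsewhere.
\<close>

definition ternary :: "(nat \<Rightarrow> bool) \<Rightarrow> real" where
  "ternary b = (\<Sum>i. 2 / 3 * of_bool (b i) * (1/3) ^ i)"

lemma summable_ternary: "summable (\<lambda>i. 2 / 3 * of_bool (b i) * (1/3::real) ^ i)"
  by (rule summable_comparison_test'[where g = "\<lambda>i. (1/3::real)^i" and N = 0])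
     (auto intro!: summable_geometric)

lemma ternary_bounds: "0 \<le> ternary b" "ternary b \<le> 1"
proof -
  show "0 \<le> ternary b" unfolding ternary_def
    by (intro suminf_nonneg summable_ternary) auto
  have "ternary b \<le> (\<Sum>i. 2 / 3 * (1/3::real) ^ i)"
    unfolding ternary_def
    by (intro suminf_le summable_ternary summable_mult summable_geometric) (auto simp: of_bool_def)
  also have "\<dots> = 1"
    by (subst suminf_mult) (auto simp: suminf_geometric intro!: summable_geometric)
  finally show "ternary b \<le> 1" .
qed

lemma ternary_Suc: "3 * ternary b = 2 * of_bool (b 0) + ternary (\<lambda>i. b (Suc i))"
proof -
  have "ternary b = 2/3 * of_bool (b 0) + (\<Sum>i. 1/3 * (2 / 3 * of_bool (b (Suc i)) * (1/3::real) ^ i))"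
    unfolding ternary_def
    using suminf_split_head[OF summable_ternary[of b]] by (simp add: mult_ac)
  also have "\<dots> = 2/3 * of_bool (b 0) + 1/3 * ternary (\<lambda>i. b (Suc i))"
    unfolding ternary_def by (simp only: suminf_mult[OF summable_ternary])
  finally show ?thesis by simp
qed

lemma bump_ternary: "bump (3 ^ m * ternary b) = of_bool (b m)"
proof (induction m arbitrary: b)
  case 0
  have 3: "ternary b = (2 * of_bool (b 0) + ternary (\<lambda>i. b (Suc i))) / 3"
    using ternary_Suc[of b] by simp
  show ?case
    using ternary_bounds[of "\<lambda>i. b (Suc i)"] 3 by (cases "b 0") (auto intro!: bump_eq_0 bump_eq_1)
next
  case (Suc m)
  have "3 ^ Suc m * ternary b = 3 ^ m * (2 * of_bool (b 0) + ternary (\<lambda>i. b (Suc i)))"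
    by (simp flip: ternary_Suc)
  also have "\<dots> = 2 * real (3 ^ m * of_bool (b 0)) + 3 ^ m * ternary (\<lambda>i. b (Suc i))"
    by (simp add: algebra_simps)
  finally show ?case by (simp only: bump_periodic Suc.IH)
qed

lemma binary_expansion:
  assumes "0 \<le> z" "z < (1::real)"
  obtains a :: "nat \<Rightarrow> bool" where "(\<lambda>j. 1/2 * of_bool (a j) * (1/2) ^ j) sums z"
proof
  define a where "a j = odd \<lfloor>2 ^ Suc j * z\<rfloor>" for j
  have digit: "\<lfloor>2 * y\<rfloor> = 2 * \<lfloor>y\<rfloor> + of_bool (odd \<lfloor>2 * y\<rfloor>)" for y :: real
  proof -
    have "\<lfloor>2 * y\<rfloor> = 2 * \<lfloor>y\<rfloor> \<or> \<lfloor>2 * y\<rfloor> = 2 * \<lfloor>y\<rfloor> + 1" by linarith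
    then show ?thesis by auto
  qed
  have partial: "(\<Sum>j<n. 1/2 * of_bool (a j) * (1/2) ^ j) = \<lfloor>2 ^ n * z\<rfloor> / 2 ^ n" for n
  proof (induction n)
    case 0 show ?case using assms by (simp add: floor_eq_iff)
  next
    case (Suc n)
    have "real_of_int \<lfloor>2 ^ Suc n * z\<rfloor> = 2 * \<lfloor>2 ^ n * z\<rfloor> + of_bool (a n)"
      using digit[of "2 ^ n * z"] unfolding a_def by (simp add: mult.assoc)
    then show ?case by (simp only: sum.lessThan_Suc Suc.IH) (simp add: field_simps power_one_over)
  qed
  have "(\<lambda>n. \<lfloor>2 ^ n * z\<rfloor> / 2 ^ n) \<longlonglongrightarrow> z"
  proof (rule tendsto_sandwich[where f = "\<lambda>n. z - (1/2)^n" and h = "\<lambda>n. z"])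
    show "(\<lambda>n. z - (1/2)^n) \<longlonglongrightarrow> z"
      using tendsto_diff[OF tendsto_const LIMSEQ_realpow_zero[of "1/2::real"], of z] by simp
    have "z - (1/2)^n \<le> \<lfloor>2 ^ n * z\<rfloor> / 2 ^ n" for n
    proof -
      have "(2 ^ n * z - 1) / 2 ^ n \<le> \<lfloor>2 ^ n * z\<rfloor> / 2 ^ n"
        by (intro divide_right_mono) (linarith, simp)
      then show ?thesis by (simp add: field_simps power_one_over)
    qed
    then show "\<forall>\<^sub>F n in sequentially. z - (1/2)^n \<le> \<lfloor>2 ^ n * z\<rfloor> / 2 ^ n" by simp
    have "\<lfloor>2 ^ n * z\<rfloor> / 2 ^ n \<le> z" for n
      by (simp add: field_simps)
    then show "\<forall>\<^sub>F n in sequentially. \<lfloor>2 ^ n * z\<rfloor> / 2 ^ n \<le> z" by simp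
  qed simp
  then show "(\<lambda>j. 1/2 * of_bool (a j) * (1/2) ^ j) sums z"
    by (simp only: sums_def partial)
qed

text \<open>
  The \<open>i\<close>-th of \<open>n\<close> coordinates of the curve: on the Cantor set, its \<open>j\<close>-th binary digit is the ternary
  digit of \<open>t\<close> at position \<open>n * j + i\<close>, halved.
\<close>

definition coord :: "nat \<Rightarrow> nat \<Rightarrow> real \<Rightarrow> real" where
  "coord n i t = (\<Sum>j. 1/2 * bump (3 ^ (n * j + i) * t) * (1/2) ^ j)"

lemma continuous_coord: "continuous_on UNIV (coord n i)"
proof -
  have "uniform_limit UNIV (\<lambda>N t. \<Sum>j<N. 1/2 * bump (3 ^ (n * j + i) * t) * (1/2) ^ j)
          (\<lambda>t. \<Sum>j. 1/2 * bump (3 ^ (n * j + i) * t) * (1/2) ^ j) sequentially"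
    using bump_bounds
    by (intro Weierstrass_m_test[where M = "\<lambda>j. (1/2) ^ j"] summable_geometric)
       (auto intro!: mult_left_le_one_le simp: abs_mult le_divide_eq_1 field_simps intro: order_trans[of _ 1])
  then have "continuous_on UNIV (\<lambda>t. \<Sum>j. 1/2 * bump (3 ^ (n * j + i) * t) * (1/2) ^ j)"
    by (rule uniform_limit_theorem[rotated])
       (auto intro!: always_eventually continuous_intros continuous_on_compose2[OF continuous_bump[of UNIV]])
  then show ?thesis by (simp add: coord_def[abs_def])
qed

lemma coord_periodic: "coord n i (2 * real N + t) = coord n i t"
proof -
  have "3 ^ k * (2 * real N + t) = 2 * real (3 ^ k * N) + 3 ^ k * t" for k
    by (simp add: algebra_simps)
  then show ?thesis unfolding coord_def by (simp only: bump_periodic)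
qed

lemma coord_onto_cube:
  assumes z: "\<And>i. i < n \<Longrightarrow> 0 \<le> z i \<and> z i < (1::real)"
  shows "\<exists>t\<in>{0..1}. \<forall>i<n. coord n i t = z i"
proof -
  have "\<forall>i\<in>{..<n}. \<exists>a :: nat \<Rightarrow> bool. (\<lambda>j. 1/2 * of_bool (a j) * (1/2) ^ j) sums z i"
    using z binary_expansion by (metis lessThan_iff)
  then obtain a :: "nat \<Rightarrow> nat \<Rightarrow> bool"
    where a: "\<And>i. i < n \<Longrightarrow> (\<lambda>j. 1/2 * of_bool (a i j) * (1/2) ^ j) sums z i"
    by (metis bchoice lessThan_iff)
  \<comment> \<open>the binary digits of all coordinates, interleaved\<close>
  define t where "t = ternary (\<lambda>m. a (m mod n) (m div n))"
  have "coord n i t = z i" if "i < n" for i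
  proof -
    have "bump (3 ^ (n * j + i) * t) = of_bool (a i j)" for j
      using that by (simp add: t_def bump_ternary)
    then show ?thesis using sums_unique[OF a[OF that]] by (simp add: coord_def)
  qed
  moreover have "t \<in> {0..1}" using ternary_bounds by (simp add: t_def)
  ultimately show ?thesis by blast
qed

text \<open>
  Scaling the curve by a factor that is constant on the intervals \<open>[2N, 2N + 1]\<close> and grows with \<open>N\<close>
  makes it exhaust the whole space, and every ball is already covered by a bounded time interval.
\<close>

theorem space_filling_curve:
  "\<exists>\<gamma> :: real \<Rightarrow> 'a::euclidean_space.
     continuous_on UNIV \<gamma> \<and> (\<forall>R. \<exists>T. cball 0 R \<subseteq> \<gamma> ` {0..T})"
proof -
  let ?n = "DIM('a)"
  obtain e :: "'a \<Rightarrow> nat" where e: "bij_betw e Basis {0..<?n}"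
    using ex_bij_betw_finite_nat[OF finite_Basis] by blast
  \<comment> \<open>subtracting a triangle wave of period 2 makes the identity constant on each [2N, 2N + 1]\<close>
  define g :: "real \<Rightarrow> real" where "g t = t - arccos (cos (pi * t)) / pi" for t
  define \<gamma> :: "real \<Rightarrow> 'a" where
    "\<gamma> t = (\<Sum>b\<in>Basis. (g t * (coord ?n (e b) t - 1/2)) *\<^sub>R b)" for t
  have "continuous_on UNIV g"
    unfolding g_def by (intro continuous_intros) auto
  then have cont: "continuous_on UNIV \<gamma>"
    unfolding \<gamma>_def by (intro continuous_intros continuous_coord)
  have g: "g (2 * real N + t) = 2 * real N" if "t \<in> {0..1}" for N t
  proof -
    have "pi * (2 * real N + t) = 2 * real N * pi + pi * t" by (simp add: algebra_simps)
    then have "cos (pi * (2 * real N + t)) = cos (pi * t)"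
      by (simp add: cos_add)
    then show ?thesis using that by (simp add: g_def arccos_cos)
  qed
  have "\<exists>T. cball 0 R \<subseteq> \<gamma> ` {0..T}" for R
  proof -
    obtain N :: nat where N: "R < N" "0 < N"
      by (metis gr0I less_trans of_nat_0_less_iff reals_Archimedean2 of_nat_less_iff zero_less_Suc lessI)
    have "z \<in> \<gamma> ` {0..2 * real N + 1}" if "norm z \<le> R" for z :: 'a
    proof -
      \<comment> \<open>the cube coordinates that the curve, centred and scaled by 2N, must attain\<close>
      define w where "w i = z \<bullet> inv_into Basis e i / (2 * N) + 1/2" for i
      have "0 \<le> w i \<and> w i < 1" if i: "i < ?n" for i
      proof -
        have "inv_into Basis e i \<in> Basis"
          using e i by (metis atLeastLessThan_iff bij_betw_imp_surj_on inv_into_into zero_le)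
        then have "\<bar>z \<bullet> inv_into Basis e i\<bar> < N"
          using Basis_le_norm[of "inv_into Basis e i" z] \<open>norm z \<le> R\<close> N by linarith
        then show ?thesis using N by (auto simp: w_def field_simps abs_less_iff)
      qed
      from coord_onto_cube[of ?n w, OF this]
      obtain t where t: "t \<in> {0..1}" "\<And>i. i < ?n \<Longrightarrow> coord ?n i t = w i" by blast
      have "\<gamma> (2 * real N + t) = (\<Sum>b\<in>Basis. (z \<bullet> b) *\<^sub>R b)"
        unfolding \<gamma>_def
      proof (intro sum.cong refl)
        fix b :: 'a assume b: "b \<in> Basis"
        then have "e b < ?n" using e by (auto simp: bij_betw_def)
        moreover have "inv_into Basis e (e b) = b"
          using e b by (simp add: bij_betw_def inv_into_f_f)
        ultimately show "(g (2 * real N + t) * (coord ?n (e b) (2 * real N + t) - 1/2)) *\<^sub>R b = (z \<bullet> b) *\<^sub>R b"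
          using t N by (simp add: g coord_periodic w_def)
      qed
      then show ?thesis using t by (intro image_eqI[of _ _ "2 * real N + t"]) (auto simp: euclidean_representation)
    qed
    then show "\<exists>T. cball 0 R \<subseteq> \<gamma> ` {0..T}" by (auto simp: subset_iff)
  qed
  with cont show ?thesis by blast
qed

section \<open>Convergent representations of tight sequences\<close>

text \<open>
  The section picks the first time at which the curve visits a point.  Its sublevel sets are images
  of compact intervals, hence closed.
\<close>

lemma borel_section_of_curve:
  fixes \<gamma> :: "real \<Rightarrow> 'a::euclidean_space"
  assumes cont: "continuous_on UNIV \<gamma>" and cover: "\<And>R. \<exists>T. cball 0 R \<subseteq> \<gamma> ` {0..T}"
  obtains s :: "'a \<Rightarrow> real"
  where "s \<in> borel_measurable borel" "\<And>z. \<gamma> (s z) = z" "\<And>z T. s z \<le> T \<longleftrightarrow> z \<in> \<gamma> ` {0..T}" "\<And>z. 0 \<le> s z"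
proof
  define s where "s z = Inf {t. 0 \<le> t \<and> \<gamma> t = z}" for z
  have ne: "{t. 0 \<le> t \<and> \<gamma> t = z} \<noteq> {}" for z
    using cover[of "norm z"] by force
  have bdd: "bdd_below {t. 0 \<le> t \<and> \<gamma> t = z}" for z
    by (rule bdd_belowI[of _ 0]) auto
  have "closed {t. 0 \<le> t \<and> \<gamma> t = z}" for z
    using cont by (intro closed_Collect_conj closed_Collect_le closed_Collect_eq continuous_intros) auto
  then have s: "s z \<in> {t. 0 \<le> t \<and> \<gamma> t = z}" for z
    unfolding s_def by (intro closed_contains_Inf ne bdd)
  then show "\<gamma> (s z) = z" "0 \<le> s z" for z by auto
  show le: "s z \<le> T \<longleftrightarrow> z \<in> \<gamma> ` {0..T}" for z T
  proof
    assume "s z \<le> T" then show "z \<in> \<gamma> ` {0..T}"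
      using s[of z] by (intro image_eqI[of _ _ "s z"]) auto
  next
    assume "z \<in> \<gamma> ` {0..T}"
    then obtain t where "t \<in> {0..T}" "\<gamma> t = z" by auto
    then show "s z \<le> T"
      using cInf_lower[OF _ bdd, of t z] by (simp add: s_def)
  qed
  show "s \<in> borel_measurable borel"
  proof (rule borel_measurableI_le)
    fix T
    have "{z \<in> space borel. s z \<le> T} = \<gamma> ` {0..T}" using le by auto
    moreover have "compact (\<gamma> ` {0..T})"
      by (intro compact_continuous_image continuous_on_subset[OF cont]) auto
    ultimately show "{z \<in> space borel. s z \<le> T} \<in> sets borel" by (simp add: borel_compact)
  qed
qed

text \<open>
  Prokhorov's theorem with Skorokhod's representation built in: a subsequence consists of laws of
  random variables that converge everywhere on one probability space.
\<close>

theorem tight_imp_convergent_representation: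
  fixes M :: "nat \<Rightarrow> 'a::euclidean_space measure"
  assumes sets: "\<And>k. sets (M k) = sets borel" and prob: "\<And>k. prob_space (M k)"
    and tight: "\<And>e. e > 0 \<Longrightarrow> \<exists>R. \<forall>k. 1 - e < measure (M k) (cball 0 R)"
  shows "\<exists>r (\<Omega> :: real measure) X X'. strict_mono (r :: nat \<Rightarrow> nat) \<and> prob_space \<Omega> \<and>
     (\<forall>k. X k \<in> borel_measurable \<Omega> \<and> distr \<Omega> borel (X k) = M (r k)) \<and>
     X' \<in> borel_measurable \<Omega> \<and> (\<forall>\<omega>\<in>space \<Omega>. (\<lambda>k. X k \<omega>) \<longlonglongrightarrow> X' \<omega>)"
proof -
  obtain \<gamma> :: "real \<Rightarrow> 'a" where cont: "continuous_on UNIV \<gamma>"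
    and cover: "\<And>R. \<exists>T. cball 0 R \<subseteq> \<gamma> ` {0..T}"
    using space_filling_curve by blast
  obtain s :: "'a \<Rightarrow> real" where [measurable]: "s \<in> borel_measurable borel" and \<gamma>s: "\<And>z. \<gamma> (s z) = z"
    and s_le: "\<And>z T. s z \<le> T \<longleftrightarrow> z \<in> \<gamma> ` {0..T}" and s_nn: "\<And>z. 0 \<le> s z"
    using borel_section_of_curve[OF cont cover] by blast
  have [measurable]: "\<gamma> \<in> borel_measurable borel"
    using cont by (rule borel_measurable_continuous_onI)
  have ms[measurable]: "s \<in> borel_measurable (M k)" for k
    using sets by (simp cong: measurable_cong_sets)
  \<comment> \<open>the laws lifted to the real line along the section\<close>
  define L where "L k = distr (M k) borel s" for k
  have L: "real_distribution (L k)" for k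
    unfolding L_def by (intro prob_space.real_distribution_distr prob ms)
  have pushforward: "distr (L k) borel \<gamma> = M k" for k
  proof -
    have "distr (L k) borel \<gamma> = distr (M k) borel (\<lambda>z. z)"
      unfolding L_def by (subst distr_distr) (auto simp: comp_def \<gamma>s)
    also have "\<dots> = M k" by (rule distr_id2[OF sets[symmetric]])
    finally show ?thesis .
  qed
  have "\<exists>a b. a < b \<and> (\<forall>k. measure (L k) {a<..b} > 1 - e)" if e: "e > 0" for e
  proof -
    obtain R where R: "\<forall>k. 1 - e < measure (M k) (cball 0 R)" using tight[OF e] by blast
    obtain T where T: "cball 0 R \<subseteq> \<gamma> ` {0..T}" using cover by blast
    have "1 - e < measure (L k) {-1<..max 0 T}" for k
    proof -
      interpret prob_space "M k" by (rule prob)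
      have "cball 0 R \<subseteq> s -` {-1<..max 0 T} \<inter> space (M k)"
      proof
        fix z :: 'a assume "z \<in> cball 0 R"
        then have "s z \<le> T" using T s_le by auto
        then show "z \<in> s -` {-1<..max 0 T} \<inter> space (M k)"
          using s_nn[of z] sets_eq_imp_space_eq[OF sets] by auto
      qed
      then have "measure (M k) (cball 0 R) \<le> measure (L k) {-1<..max 0 T}"
        unfolding L_def by (subst measure_distr) (auto intro!: finite_measure_mono)
      with R show ?thesis by (meson less_le_trans)
    qed
    then show ?thesis by (intro exI[of _ "-1"] exI[of _ "max 0 T"]) auto
  qed
  then have "tight L" using L by (simp add: tight_def)
  from tight_imp_convergent_subsubsequence[OF this strict_mono_id]
  obtain r N where r: "strict_mono (r :: nat \<Rightarrow> nat)" "real_distribution N" "weak_conv_m (\<lambda>k. L (r k)) N"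
    by (auto simp: comp_def)
  from Skorohod[of "\<lambda>k. L (r k)" N, OF L r(2,3)]
  obtain \<Omega> :: "real measure" and Y Y' where Y: "prob_space \<Omega>"
      "\<And>k. Y k \<in> borel_measurable \<Omega>" "\<And>k. distr \<Omega> borel (Y k) = L (r k)"
      "Y' \<in> measurable \<Omega> lborel" "\<And>\<omega>. \<omega> \<in> space \<Omega> \<Longrightarrow> (\<lambda>k. Y k \<omega>) \<longlonglongrightarrow> Y' \<omega>"
    by blast
  note Y(2)[measurable]
  have [measurable]: "Y' \<in> borel_measurable \<Omega>" using Y(4) by simp
  show ?thesis
  proof (intro exI conjI allI ballI)
    show "strict_mono r" "prob_space \<Omega>" by fact+
    show "(\<lambda>\<omega>. \<gamma> (Y k \<omega>)) \<in> borel_measurable \<Omega>" for k by measurable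
    show "distr \<Omega> borel (\<lambda>\<omega>. \<gamma> (Y k \<omega>)) = M (r k)" for k
      using distr_distr[of \<gamma> borel borel "Y k" \<Omega>] pushforward[of "r k"] Y(3)[of k] by (simp add: comp_def)
    show "(\<lambda>\<omega>. \<gamma> (Y' \<omega>)) \<in> borel_measurable \<Omega>" by measurable
    show "(\<lambda>k. \<gamma> (Y k \<omega>)) \<longlonglongrightarrow> \<gamma> (Y' \<omega>)" if "\<omega> \<in> space \<Omega>" for \<omega>
      using continuous_on_tendsto_compose[OF cont Y(5)[OF that]] by simp
  qed
qed

section \<open>Limits of laws and couplings\<close>

lemma finite_measure_eqI_lipschitz:
  fixes M N :: "'a::metric_space measure"
  assumes M: "sets M = sets borel" "finite_measure M" and N: "sets N = sets borel" "finite_measure N"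
    and eq: "\<And>f :: 'a \<Rightarrow> real. \<exists>L. L-lipschitz_on UNIV f \<Longrightarrow> (\<And>x. 0 \<le> f x \<and> f x \<le> 1) \<Longrightarrow>
      (\<integral>x. f x \<partial>M) = (\<integral>x. f x \<partial>N)"
  shows "M = N"
proof -
  have closed: "measure M C = measure N C" if C: "closed C" for C
  proof (cases "C = {}")
    case False
    \<comment> \<open>Lipschitz functions decreasing to the indicator of the closed set\<close>
    define f where "f m x = max 0 (1 - real m * infdist x C)" for m x
    have lip: "\<exists>L. L-lipschitz_on UNIV (f m)" for m
    proof (intro exI lipschitz_onI)
      fix x y
      have "\<bar>infdist x C - infdist y C\<bar> \<le> dist x y"
        using infdist_triangle[of x C y] infdist_triangle[of y C x] by (simp add: dist_commute abs_le_iff)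
      then have "real m * \<bar>infdist x C - infdist y C\<bar> \<le> real m * dist x y"
        by (rule mult_left_mono) simp
      moreover have "dist (f m x) (f m y) \<le> \<bar>real m * infdist x C - real m * infdist y C\<bar>"
        by (simp add: f_def dist_real_def max_def abs_if)
      moreover have "\<bar>real m * infdist x C - real m * infdist y C\<bar> = real m * \<bar>infdist x C - infdist y C\<bar>"
        by (simp add: abs_mult flip: right_diff_distrib)
      ultimately show "dist (f m x) (f m y) \<le> real m * dist x y" by linarith
    qed simp
    have bounds: "0 \<le> f m x \<and> f m x \<le> 1" for m x
      by (simp add: f_def infdist_nonneg)
    have lim: "(\<lambda>m. f m x) \<longlonglongrightarrow> indicator C x" for x
    proof (cases "x \<in> C")
      case True then show ?thesis by (simp add: f_def)
    next
      case False
      then have "infdist x C > 0"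
        using in_closed_iff_infdist_zero[OF C \<open>C \<noteq> {}\<close>] infdist_nonneg[of x C] by (simp add: less_le)
      then obtain k :: nat where k: "1 < real k * infdist x C"
        using ex_less_of_nat_mult by blast
      have "f m x = 0" if "m \<ge> k" for m
      proof -
        have "real k * infdist x C \<le> real m * infdist x C"
          using that infdist_nonneg by (intro mult_right_mono) auto
        then show ?thesis using k by (simp add: f_def)
      qed
      then show ?thesis
        using False by (intro tendsto_eventually) (auto simp: eventually_sequentially)
    qed
    have conv: "(\<lambda>m. \<integral>x. f m x \<partial>K) \<longlonglongrightarrow> measure K C"
      if K: "sets K = sets borel" "finite_measure K" for K
    proof -
      interpret K: finite_measure K by (rule K)
      have [measurable]: "f m \<in> borel_measurable K" for m
      proof -
        obtain L where "L-lipschitz_on UNIV (f m)" using lip by blast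
        then have "f m \<in> borel_measurable borel"
          by (intro borel_measurable_continuous_onI lipschitz_on_continuous_on)
        then show ?thesis using K(1) by (simp cong: measurable_cong_sets)
      qed
      have [measurable]: "C \<in> sets K" using C K by simp
      have "(\<lambda>m. \<integral>x. f m x \<partial>K) \<longlonglongrightarrow> (\<integral>x. indicator C x \<partial>K)"
        by (rule integral_dominated_convergence[where w = "\<lambda>x. 1"])
           (use bounds lim in auto)
      then show ?thesis by simp
    qed
    show ?thesis
      using LIMSEQ_unique[OF conv[OF M] conv[OF N, folded eq[OF lip bounds]]] .
  qed simp
  show ?thesis
  proof (rule measure_eqI_generator_eq[where E = "Collect closed" and \<Omega> = UNIV and A = "\<lambda>i. UNIV"])
    show "sets M = sigma_sets UNIV (Collect closed)" "sets N = sigma_sets UNIV (Collect closed)"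
      using M N by (simp_all add: borel_eq_closed)
    show "emeasure M X = emeasure N X" if "X \<in> Collect closed" for X
      using closed[of X] that M(2) N(2) by (simp add: finite_measure.emeasure_eq_measure)
    show "emeasure M UNIV \<noteq> \<infinity>"
      using M(2) by (simp add: finite_measure.emeasure_eq_measure)
  qed (auto simp: Int_stable_def)
qed

lemma weakly_converges_distr:
  fixes X :: "nat \<Rightarrow> 'w \<Rightarrow> 'a::metric_space"
  assumes \<Omega>: "finite_measure \<Omega>"
    and X[measurable]: "\<And>k. X k \<in> borel_measurable \<Omega>" "X' \<in> borel_measurable \<Omega>"
    and lim: "\<And>\<omega>. \<omega> \<in> space \<Omega> \<Longrightarrow> (\<lambda>k. X k \<omega>) \<longlonglongrightarrow> X' \<omega>"
  shows "weakly_converges (\<lambda>k. distr \<Omega> borel (X k)) (distr \<Omega> borel X')"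
  unfolding weakly_converges_def
proof (intro allI impI)
  interpret finite_measure \<Omega> by (rule \<Omega>)
  fix f :: "'a \<Rightarrow> real" assume f: "continuous_on UNIV f" "bounded (range f)"
  from f(1) have [measurable]: "f \<in> borel_measurable borel" by (rule borel_measurable_continuous_onI)
  obtain B where B: "\<And>x. norm (f x) \<le> B" using f(2) by (auto simp: bounded_iff)
  have "(\<lambda>k. \<integral>\<omega>. f (X k \<omega>) \<partial>\<Omega>) \<longlonglongrightarrow> (\<integral>\<omega>. f (X' \<omega>) \<partial>\<Omega>)"
    by (rule integral_dominated_convergence[where w = "\<lambda>_. B"])
       (use B in \<open>auto intro!: AE_I2 continuous_on_tendsto_compose[OF f(1) lim]\<close>)
  then show "(\<lambda>k. \<integral>x. f x \<partial>distr \<Omega> borel (X k)) \<longlonglongrightarrow> (\<integral>x. f x \<partial>distr \<Omega> borel X')"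
    by (simp add: integral_distr)
qed

text \<open>
  The law of a pointwise limit is determined by the limits of the integrals of bounded Lipschitz
  functions.
\<close>

lemma distr_limit_eq:
  fixes X :: "nat \<Rightarrow> 'w \<Rightarrow> 'a::metric_space"
  assumes \<Omega>: "finite_measure \<Omega>"
    and X: "\<And>k. X k \<in> borel_measurable \<Omega>" "X' \<in> borel_measurable \<Omega>"
    and lim: "\<And>\<omega>. \<omega> \<in> space \<Omega> \<Longrightarrow> (\<lambda>k. X k \<omega>) \<longlonglongrightarrow> X' \<omega>"
    and N: "sets N = sets borel" "finite_measure N"
    and conv: "\<And>f :: 'a \<Rightarrow> real. \<exists>L. L-lipschitz_on UNIV f \<Longrightarrow> (\<And>x. 0 \<le> f x \<and> f x \<le> 1) \<Longrightarrow>
      (\<lambda>k. \<integral>x. f x \<partial>distr \<Omega> borel (X k)) \<longlonglongrightarrow> (\<integral>x. f x \<partial>N)"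
  shows "distr \<Omega> borel X' = N"
proof (rule finite_measure_eqI_lipschitz[OF _ _ N])
  show "finite_measure (distr \<Omega> borel X')" using \<Omega> X(2) by (rule finite_measure.finite_measure_distr)
  fix f :: "'a \<Rightarrow> real" assume f: "\<exists>L. L-lipschitz_on UNIV f" "\<And>x. 0 \<le> f x \<and> f x \<le> 1"
  have "bounded (range f)" using f(2) by (intro boundedI[where B = 1]) auto
  then have "(\<lambda>k. \<integral>x. f x \<partial>distr \<Omega> borel (X k)) \<longlonglongrightarrow> (\<integral>x. f x \<partial>distr \<Omega> borel X')"
    using weakly_converges_distr[OF \<Omega> X lim] f(1) lipschitz_on_continuous_on
    unfolding weakly_converges_def by blast
  then show "(\<integral>x. f x \<partial>distr \<Omega> borel X') = (\<integral>x. f x \<partial>N)"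
    using conv[OF f] by (rule LIMSEQ_unique)
qed simp

lemma couplingsD:
  fixes \<mu> :: "'a::euclidean_space measure" and \<nu> :: "'b::euclidean_space measure"
  assumes "\<pi> \<in> couplings \<mu> \<nu>"
  shows "sets \<pi> = sets borel" "prob_space \<pi>" "distr \<pi> borel fst = \<mu>" "distr \<pi> borel snd = \<nu>"
    "fst \<in> borel_measurable \<pi>" "snd \<in> borel_measurable \<pi>" "space \<pi> = UNIV"
proof -
  show "sets \<pi> = sets borel" "prob_space \<pi>" "distr \<pi> borel fst = \<mu>" "distr \<pi> borel snd = \<nu>"
    using assms by (auto simp: couplings_def)
  then have [measurable_cong]: "sets \<pi> = sets (borel \<Otimes>\<^sub>M borel)"
    unfolding borel_prod by simp
  show "fst \<in> borel_measurable \<pi>" "snd \<in> borel_measurable \<pi>"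
    by measurable
  show "space \<pi> = UNIV"
    using sets_eq_imp_space_eq[OF \<open>sets \<pi> = sets borel\<close>] by simp
qed

lemma couplings_tight:
  fixes \<mu> :: "'a::euclidean_space measure" and \<nu> :: "'b::euclidean_space measure"
  assumes \<mu>: "sets \<mu> = sets borel" "prob_space \<mu>" and \<nu>: "sets \<nu> = sets borel" "prob_space \<nu>"
    and "e > 0"
  shows "\<exists>R. \<forall>\<pi>\<in>couplings \<mu> \<nu>. 1 - e < measure \<pi> (cball 0 R)"
proof -
  have ex: "\<exists>n. 1 - e/2 < measure M (cball 0 (real n))"
    if M: "sets M = sets borel" "prob_space M" for M :: "'c::euclidean_space measure"
  proof -
    interpret prob_space M by (rule M)
    have "(\<lambda>n. measure M (cball 0 (real n))) \<longlonglongrightarrow> measure M (\<Union>n. cball 0 (real n))"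
    proof (rule finite_Lim_measure_incseq)
      show "range (\<lambda>n. cball 0 (real n)) \<subseteq> events" by (simp add: M(1) image_subset_iff)
      show "incseq (\<lambda>n. cball (0::'c) (real n))" by (intro monoI subset_cball) simp
    qed
    also have "(\<Union>n. cball (0::'c) (real n)) = space M"
      unfolding sets_eq_imp_space_eq[OF M(1)] by (auto intro: real_arch_simple)
    finally have "(\<lambda>n. measure M (cball 0 (real n))) \<longlonglongrightarrow> 1" by (simp only: prob_space)
    then have "\<forall>\<^sub>F n in sequentially. 1 - e/2 < measure M (cball 0 (real n))"
      by (rule order_tendstoD) (use \<open>e > 0\<close> in simp)
    then show ?thesis by (rule eventually_happens'[OF sequentially_bot])
  qed
  from ex[OF \<mu>] ex[OF \<nu>] obtain m n where
    mn: "1 - e/2 < measure \<mu> (cball 0 (real m))" "1 - e/2 < measure \<nu> (cball 0 (real n))" by blast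
  have "1 - e < measure \<pi> (cball 0 (real m + real n))" if \<pi>: "\<pi> \<in> couplings \<mu> \<nu>" for \<pi>
  proof -
    note c = couplingsD[OF \<pi>]
    interpret prob_space \<pi> by (rule c)
    let ?A = "fst -` cball 0 (real m) :: ('a \<times> 'b) set" and ?B = "snd -` cball 0 (real n) :: ('a \<times> 'b) set"
    have "measure \<mu> (cball 0 (real m)) = measure \<pi> (?A \<inter> space \<pi>)"
      unfolding c(3)[symmetric] using c(5) by (simp add: measure_distr)
    moreover have "measure \<nu> (cball 0 (real n)) = measure \<pi> (?B \<inter> space \<pi>)"
      unfolding c(4)[symmetric] using c(6) by (simp add: measure_distr)
    moreover have [measurable]: "?A \<in> events" "?B \<in> events"
      using measurable_sets[OF c(5), of "cball 0 (real m)"] measurable_sets[OF c(6), of "cball 0 (real n)"] c(7) by auto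
    moreover have "1 - measure \<pi> (?A \<inter> ?B) \<le> (1 - measure \<pi> ?A) + (1 - measure \<pi> ?B)"
    proof -
      have "measure \<pi> (?A \<union> ?B) + measure \<pi> (?A \<inter> ?B) = measure \<pi> ?A + measure \<pi> ?B"
        using finite_measure_Union'[of ?A ?B] finite_measure_Diff'[of ?B ?A] by (simp add: Int_commute)
      then show ?thesis using prob_le_1[of "?A \<union> ?B"] by linarith
    qed
    moreover have "measure \<pi> (?A \<inter> ?B) \<le> measure \<pi> (cball 0 (real m + real n))"
    proof (rule finite_measure_mono)
      show "?A \<inter> ?B \<subseteq> cball 0 (real m + real n)"
        by (auto intro: order_trans[OF norm_Pair_le add_mono])
    qed (simp add: c(1))
    ultimately show ?thesis using mn c(7) by simp
  qed
  then show ?thesis by blast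
qed

section \<open>Continuity of the distortion\<close>

text \<open>
  The integrand of the distortion, and a bound for it by fourth powers of the four points.  The bound
  separates the variables, so its integral depends on the marginals only.
\<close>

definition gw_cost :: "('a::euclidean_space \<times> 'b::euclidean_space) \<times> ('a \<times> 'b) \<Rightarrow> real" where
  "gw_cost z = ((norm (fst (fst z) - fst (snd z)))\<^sup>2 - (norm (snd (fst z) - snd (snd z)))\<^sup>2)\<^sup>2"

definition gw_bound :: "('a::euclidean_space \<times> 'b::euclidean_space) \<times> ('a \<times> 'b) \<Rightarrow> real" where
  "gw_bound z = 8 * (norm (fst (fst z)) ^ 4 + norm (snd (fst z)) ^ 4)
              + 8 * (norm (fst (snd z)) ^ 4 + norm (snd (snd z)) ^ 4)"

lemma gw_distortion_eq: "gw_distortion \<pi> = (\<integral>\<^sup>+ z. ennreal (gw_cost z) \<partial>(\<pi> \<Otimes>\<^sub>M \<pi>))"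
  unfolding gw_distortion_def by (intro nn_integral_cong) (auto simp: gw_cost_def)

lemma gw_cost_nonneg: "0 \<le> gw_cost z"
  by (simp add: gw_cost_def)

lemma gw_cost_le_bound: "gw_cost z \<le> gw_bound z"
proof -
  have sq: "(a + b)\<^sup>2 \<le> 2 * (a\<^sup>2 + b\<^sup>2)" for a b :: real
    using sum_squares_ge_zero[of "a - b" 0] by (simp add: power2_eq_square algebra_simps)
  have four: "norm (x - y) ^ 4 \<le> 8 * (norm x ^ 4 + norm y ^ 4)" for x y :: "'c::real_normed_vector"
  proof -
    have "norm (x - y) ^ 4 \<le> (norm x + norm y) ^ 4"
      by (intro power_mono norm_triangle_ineq4) simp
    also have "\<dots> = ((norm x + norm y)\<^sup>2)\<^sup>2" by simp
    also have "\<dots> \<le> (2 * ((norm x)\<^sup>2 + (norm y)\<^sup>2))\<^sup>2"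
      by (intro power_mono sq) simp
    also have "\<dots> = 4 * ((norm x)\<^sup>2 + (norm y)\<^sup>2)\<^sup>2" by (simp only: power_mult_distrib) simp
    also have "\<dots> \<le> 8 * (norm x ^ 4 + norm y ^ 4)"
      using sq[of "(norm x)\<^sup>2" "(norm y)\<^sup>2"] by simp
    finally show ?thesis .
  qed
  have "(a\<^sup>2 - b\<^sup>2)\<^sup>2 \<le> a ^ 4 + b ^ 4" for a b :: real
  proof -
    have "(a\<^sup>2 - b\<^sup>2)\<^sup>2 = a ^ 4 + b ^ 4 - 2 * (a\<^sup>2 * b\<^sup>2)" by (simp add: power2_eq_square power4_eq_xxxx algebra_simps)
    then show ?thesis by simp
  qed
  from this[of "norm (fst (fst z) - fst (snd z))" "norm (snd (fst z) - snd (snd z))"]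
  show ?thesis
    using four[of "fst (fst z)" "fst (snd z)"] four[of "snd (fst z)" "snd (snd z)"]
    by (simp add: gw_cost_def gw_bound_def)
qed

lemma continuous_gw_cost: "continuous_on UNIV gw_cost"
  unfolding gw_cost_def by (intro continuous_intros)

lemma continuous_gw_bound: "continuous_on UNIV gw_bound"
  unfolding gw_bound_def by (intro continuous_intros)

lemma integral_gw_bound:
  assumes P4: "\<mu> \<in> P4" "\<nu> \<in> P4"
  shows "\<exists>H. H < \<infinity> \<and> (\<forall>\<pi>\<in>couplings \<mu> \<nu>. (\<integral>\<^sup>+ z. ennreal (gw_bound z) \<partial>(\<pi> \<Otimes>\<^sub>M \<pi>)) = H)"
proof -
  let ?m = "(\<integral>\<^sup>+ x. ennreal (norm x ^ 4) \<partial>\<mu>) + (\<integral>\<^sup>+ y. ennreal (norm y ^ 4) \<partial>\<nu>)"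
  have "(\<integral>\<^sup>+ z. ennreal (gw_bound z) \<partial>(\<pi> \<Otimes>\<^sub>M \<pi>)) = 8 * ?m + 8 * ?m" if \<pi>: "\<pi> \<in> couplings \<mu> \<nu>" for \<pi>
  proof -
    note c = couplingsD[OF \<pi>]
    note c(5,6)[measurable]
    interpret prob_space \<pi> by (rule c)
    let ?g = "\<lambda>w. ennreal (8 * (norm (fst w) ^ 4 + norm (snd w) ^ 4))"
    have g[measurable]: "?g \<in> borel_measurable \<pi>" by measurable
    have gi: "(\<integral>\<^sup>+ w. ?g w \<partial>\<pi>) = 8 * ?m"
    proof -
      have "(\<integral>\<^sup>+ w. ?g w \<partial>\<pi>) = 8 * (\<integral>\<^sup>+ w. ennreal (norm (fst w) ^ 4) + ennreal (norm (snd w) ^ 4) \<partial>\<pi>)"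
        by (subst nn_integral_cmult[symmetric]) (auto simp: ennreal_mult ennreal_plus)
      also have "\<dots> = 8 * ((\<integral>\<^sup>+ w. ennreal (norm (fst w) ^ 4) \<partial>\<pi>) + (\<integral>\<^sup>+ w. ennreal (norm (snd w) ^ 4) \<partial>\<pi>))"
        by (subst nn_integral_add) auto
      also have "\<dots> = 8 * ?m"
        by (subst c(3)[symmetric], subst c(4)[symmetric], subst (1 2) nn_integral_distr) auto
      finally show ?thesis .
    qed
    have "(\<integral>\<^sup>+ z. ennreal (gw_bound z) \<partial>(\<pi> \<Otimes>\<^sub>M \<pi>)) = (\<integral>\<^sup>+ z. ?g (fst z) + ?g (snd z) \<partial>(\<pi> \<Otimes>\<^sub>M \<pi>))"
      by (intro nn_integral_cong) (simp add: gw_bound_def ennreal_plus)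
    also have "\<dots> = (\<integral>\<^sup>+ z. ?g (fst z) \<partial>(\<pi> \<Otimes>\<^sub>M \<pi>)) + (\<integral>\<^sup>+ z. ?g (snd z) \<partial>(\<pi> \<Otimes>\<^sub>M \<pi>))"
      by (intro nn_integral_add) measurable
    also have "(\<integral>\<^sup>+ z. ?g (fst z) \<partial>(\<pi> \<Otimes>\<^sub>M \<pi>)) = 8 * ?m"
      by (subst nn_integral_fst[symmetric], measurable) (simp only: fst_conv nn_integral_const emeasure_space_1 mult_1_right gi)
    also have "(\<integral>\<^sup>+ z. ?g (snd z) \<partial>(\<pi> \<Otimes>\<^sub>M \<pi>)) = 8 * ?m"
      by (subst nn_integral_fst[symmetric], measurable) (simp only: snd_conv nn_integral_const emeasure_space_1 mult_1_right gi)
    finally show ?thesis .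
  qed
  moreover have "8 * ?m + 8 * ?m < \<infinity>"
    using P4 by (auto simp: P4_def ennreal_mult_less_top)
  ultimately show ?thesis by blast
qed

text \<open>
  Two lower semicontinuous quantities with a constant finite sum are continuous.
\<close>

lemma tendsto_of_sum_constant:
  fixes a b :: "nat \<Rightarrow> ennreal"
  assumes sum: "\<And>k. a k + b k = H" "a' + b' = H" "H < \<infinity>"
    and a: "a' \<le> liminf a" and b: "b' \<le> liminf b"
  shows "a \<longlonglongrightarrow> a'"
proof (rule order_tendstoI)
  show "\<forall>\<^sub>F k in sequentially. y < a k" if "y < a'" for y
    using a that by (auto simp: le_Liminf_iff)
  show "\<forall>\<^sub>F k in sequentially. a k < y" if y: "a' < y" for y
  proof (cases "y \<le> H")
    case True
    have fin: "a' < \<infinity>" "b' < \<infinity>" "y < \<infinity>"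
      using sum True by (auto simp: less_top intro: le_less_trans)
    have "H - y < b'"
      using sum(2)[symmetric] fin y True by (cases a'; cases b'; cases y) (auto simp: ennreal_minus ennreal_less_iff simp flip: ennreal_plus)
    with b have "\<forall>\<^sub>F k in sequentially. H - y < b k" by (auto simp: le_Liminf_iff)
    then show ?thesis
    proof eventually_elim
      case (elim k)
      have fin: "a k < \<infinity>" "b k < \<infinity>" "y < \<infinity>"
        using sum(1)[of k] sum(3) fin by (auto simp: less_top)
      have False if "y \<le> a k"
        using elim sum(1)[of k, symmetric] fin that
        by (cases "a k"; cases "b k"; cases y)
           (auto simp: ennreal_minus ennreal_less_iff simp flip: ennreal_plus)
      then show ?case by (meson not_less)
    qed
  next
    case False
    have "a k \<le> H" for k using sum(1)[of k] by (metis le_iff_add)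
    then have "a k < y" for k using False by (meson le_less_trans not_less)
    then show ?thesis by simp
  qed
qed

lemma gw_distortion_limit:
  fixes \<mu> :: "'a::euclidean_space measure" and \<nu> :: "'b::euclidean_space measure"
    and X :: "nat \<Rightarrow> 'w \<Rightarrow> 'a \<times> 'b"
  assumes P4: "\<mu> \<in> P4" "\<nu> \<in> P4" and \<Omega>: "prob_space \<Omega>"
    and X[measurable]: "\<And>k. X k \<in> borel_measurable \<Omega>" "X' \<in> borel_measurable \<Omega>"
    and cpl: "\<And>k. distr \<Omega> borel (X k) \<in> couplings \<mu> \<nu>"
    and lim: "\<And>\<omega>. \<omega> \<in> space \<Omega> \<Longrightarrow> (\<lambda>k. X k \<omega>) \<longlonglongrightarrow> X' \<omega>"
  shows "distr \<Omega> borel X' \<in> couplings \<mu> \<nu>"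
    and "(\<lambda>k. gw_distortion (distr \<Omega> borel (X k))) \<longlonglongrightarrow> gw_distortion (distr \<Omega> borel X')"
proof -
  interpret prob_space \<Omega> by (rule \<Omega>)
  have borel_fst[measurable]: "fst \<in> borel_measurable (borel :: ('a \<times> 'b) measure)" 
    and borel_snd[measurable]: "snd \<in> borel_measurable (borel :: ('a \<times> 'b) measure)"
    by (auto simp flip: borel_prod)
  have "distr \<Omega> borel (\<lambda>\<omega>. fst (X' \<omega>)) = \<mu>"
  proof (rule distr_limit_eq[where X = "\<lambda>k \<omega>. fst (X k \<omega>)"])
    have "distr \<Omega> borel (\<lambda>\<omega>. fst (X k \<omega>)) = \<mu>" for k
      using couplingsD(3)[OF cpl, of k] by (simp add: distr_distr comp_def)
    then show "(\<lambda>k. \<integral>x. f x \<partial>distr \<Omega> borel (\<lambda>\<omega>. fst (X k \<omega>))) \<longlonglongrightarrow> (\<integral>x. f x \<partial>\<mu>)" for f :: "'a \<Rightarrow> real" by simp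
  qed (use P4 in \<open>auto simp: P4_def intro: lim tendsto_intros finite_measure_axioms prob_space.finite_measure\<close>)
  moreover have "distr \<Omega> borel (\<lambda>\<omega>. snd (X' \<omega>)) = \<nu>"
  proof (rule distr_limit_eq[where X = "\<lambda>k \<omega>. snd (X k \<omega>)"])
    have "distr \<Omega> borel (\<lambda>\<omega>. snd (X k \<omega>)) = \<nu>" for k
      using couplingsD(4)[OF cpl, of k] by (simp add: distr_distr comp_def)
    then show "(\<lambda>k. \<integral>x. f x \<partial>distr \<Omega> borel (\<lambda>\<omega>. snd (X k \<omega>))) \<longlonglongrightarrow> (\<integral>x. f x \<partial>\<nu>)" for f :: "'b \<Rightarrow> real" by simp
  qed (use P4 in \<open>auto simp: P4_def intro: lim tendsto_intros finite_measure_axioms prob_space.finite_measure\<close>)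
  ultimately show cpl': "distr \<Omega> borel X' \<in> couplings \<mu> \<nu>"
    by (simp add: couplings_def distr_distr comp_def prob_space_distr)
  obtain H where H: "H < \<infinity>" "\<And>\<pi>. \<pi> \<in> couplings \<mu> \<nu> \<Longrightarrow> (\<integral>\<^sup>+ z. ennreal (gw_bound z) \<partial>(\<pi> \<Otimes>\<^sub>M \<pi>)) = H"
    using integral_gw_bound[OF P4] by blast
  let ?Z = "\<lambda>Y (\<omega>, \<omega>'). (Y \<omega>, Y \<omega>') :: ('a \<times> 'b) \<times> ('a \<times> 'b)"
  have cost[measurable]: "gw_cost \<in> borel_measurable (borel \<Otimes>\<^sub>M borel :: (('a \<times> 'b) \<times> ('a \<times> 'b)) measure)"
    and bound[measurable]: "gw_bound \<in> borel_measurable (borel \<Otimes>\<^sub>M borel :: (('a \<times> 'b) \<times> ('a \<times> 'b)) measure)"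
    using continuous_gw_cost continuous_gw_bound by (auto simp: borel_prod intro: borel_measurable_continuous_onI)
  have pull: "(\<integral>\<^sup>+ z. ennreal (f z) \<partial>(distr \<Omega> borel Y \<Otimes>\<^sub>M distr \<Omega> borel Y)) = (\<integral>\<^sup>+ w. ennreal (f (?Z Y w)) \<partial>(\<Omega> \<Otimes>\<^sub>M \<Omega>))"
    if [measurable]: "Y \<in> borel_measurable \<Omega>" "f \<in> borel_measurable (borel \<Otimes>\<^sub>M borel)" for Y f
  proof -
    have "sigma_finite_measure (distr \<Omega> borel Y)"
      by (intro prob_space_imp_sigma_finite prob_space_distr) simp
    then show ?thesis
      by (subst pair_measure_distr) (auto simp: nn_integral_distr)
  qed
  have Zlim: "(\<lambda>k. ?Z (X k) w) \<longlonglongrightarrow> ?Z X' w" if "w \<in> space (\<Omega> \<Otimes>\<^sub>M \<Omega>)" for w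
    using that by (auto simp: space_pair_measure intro!: tendsto_Pair lim)
  have fatou: "(\<integral>\<^sup>+ w. ennreal (f (?Z X' w)) \<partial>(\<Omega> \<Otimes>\<^sub>M \<Omega>)) \<le> liminf (\<lambda>k. \<integral>\<^sup>+ w. ennreal (f (?Z (X k) w)) \<partial>(\<Omega> \<Otimes>\<^sub>M \<Omega>))"
    if f: "continuous_on UNIV f" for f
  proof -
    have [measurable]: "f \<in> borel_measurable (borel \<Otimes>\<^sub>M borel)"
      using f by (auto simp: borel_prod intro: borel_measurable_continuous_onI)
    have "(\<integral>\<^sup>+ w. ennreal (f (?Z X' w)) \<partial>(\<Omega> \<Otimes>\<^sub>M \<Omega>)) = (\<integral>\<^sup>+ w. liminf (\<lambda>k. ennreal (f (?Z (X k) w))) \<partial>(\<Omega> \<Otimes>\<^sub>M \<Omega>))"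
    proof (intro nn_integral_cong)
      fix w assume "w \<in> space (\<Omega> \<Otimes>\<^sub>M \<Omega>)"
      from continuous_on_tendsto_compose[OF f Zlim[OF this]]
      have "(\<lambda>k. ennreal (f (?Z (X k) w))) \<longlonglongrightarrow> ennreal (f (?Z X' w))" by simp
      then show "ennreal (f (?Z X' w)) = liminf (\<lambda>k. ennreal (f (?Z (X k) w)))"
        by (rule lim_imp_Liminf[symmetric, rotated]) simp
    qed
    also have "\<dots> \<le> liminf (\<lambda>k. \<integral>\<^sup>+ w. ennreal (f (?Z (X k) w)) \<partial>(\<Omega> \<Otimes>\<^sub>M \<Omega>))"
      by (rule nn_integral_liminf) measurable
    finally show ?thesis .
  qed
  have split: "(\<integral>\<^sup>+ w. ennreal (gw_cost (?Z Y w)) \<partial>(\<Omega> \<Otimes>\<^sub>M \<Omega>)) + (\<integral>\<^sup>+ w. ennreal (gw_bound (?Z Y w) - gw_cost (?Z Y w)) \<partial>(\<Omega> \<Otimes>\<^sub>M \<Omega>)) = H"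
    if [measurable]: "Y \<in> borel_measurable \<Omega>" and "distr \<Omega> borel Y \<in> couplings \<mu> \<nu>" for Y
    unfolding H(2)[OF that(2), symmetric] pull[OF that(1) bound]
    by (subst nn_integral_add[symmetric], measurable)
       (intro nn_integral_cong, simp add: gw_cost_nonneg gw_cost_le_bound flip: ennreal_plus)
  show "(\<lambda>k. gw_distortion (distr \<Omega> borel (X k))) \<longlonglongrightarrow> gw_distortion (distr \<Omega> borel X')"
    unfolding gw_distortion_eq pull[OF X(1) cost] pull[OF X(2) cost]
    by (rule tendsto_of_sum_constant[OF split split H(1) fatou
          fatou[of "\<lambda>z. gw_bound z - gw_cost z"]])
       (use X cpl cpl' in \<open>auto intro!: continuous_intros continuous_gw_cost continuous_gw_bound\<close>)
qed

lemma gw_distortion_finite: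
  assumes "\<mu> \<in> P4" "\<nu> \<in> P4" "\<pi> \<in> couplings \<mu> \<nu>"
  shows "gw_distortion \<pi> < \<infinity>"
proof -
  obtain H where H: "H < \<infinity>" "(\<integral>\<^sup>+ z. ennreal (gw_bound z) \<partial>(\<pi> \<Otimes>\<^sub>M \<pi>)) = H"
    using integral_gw_bound[OF assms(1,2)] assms(3) by blast
  have "gw_distortion \<pi> \<le> H"
    unfolding gw_distortion_eq H(2)[symmetric]
    by (intro nn_integral_mono ennreal_leI gw_cost_le_bound)
  then show ?thesis using H(1) by simp
qed

section \<open>Duality and lower semicontinuity of the divergence\<close>

text \<open>
  The integrand of the divergence in terms of the density \<open>t\<close>.  The term \<open>1 - t\<close>, which integrates to
  \<open>0\<close>, makes it nonnegative.  At \<open>t = 0\<close> the convention \<open>ln 0 = 0\<close> gives the value \<open>1\<close> of the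
  continuous extension.
\<close>

definition kl_fun :: "real \<Rightarrow> real" where
  "kl_fun t = t * ln t - t + 1"

text \<open>
  Young's inequality for \<open>kl_fun\<close> and its convex conjugate \<open>\<lambda>s. exp s - 1\<close>.
\<close>

lemma kl_fun_young: assumes "0 \<le> t" shows "t * s \<le> kl_fun t + exp s - 1"
proof (cases "t = 0")
  case True then show ?thesis by (simp add: kl_fun_def)
next
  case False
  with assms have t: "t > 0" by simp
  have "t * (s - ln t) = t * ln (exp s / t)" using t by (simp add: ln_div)
  also have "\<dots> \<le> t * (exp s / t - 1)" using t by (intro mult_left_mono ln_le_minus_one) auto
  also have "\<dots> = exp s - t" using t by (simp add: field_simps)
  finally show ?thesis by (simp add: kl_fun_def algebra_simps)
qed

lemma kl_fun_nonneg: "0 \<le> t \<Longrightarrow> 0 \<le> kl_fun t"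
  using kl_fun_young[of t 0] by simp

lemma measurable_kl_fun[measurable]: "kl_fun \<in> borel_measurable borel"
  unfolding kl_fun_def by measurable

text \<open>
  In this form the divergence is one integral of a nonnegative function, instead of a difference of
  two integrals.
\<close>

lemma D_KL_density:
  assumes \<beta>: "prob_space \<beta>" and p[measurable]: "p \<in> borel_measurable \<beta>" and p0: "\<And>z. 0 \<le> p z"
    and \<alpha>: "\<alpha> = density \<beta> (\<lambda>z. ennreal (p z))" "prob_space \<alpha>"
  shows "D_KL \<alpha> \<beta> = enn2ereal (\<integral>\<^sup>+ z. ennreal (kl_fun (p z)) \<partial>\<beta>)"
proof -
  interpret \<beta>: prob_space \<beta> by (rule \<beta>)
  have ac: "absolutely_continuous \<beta> \<alpha>"
    unfolding \<alpha>(1) by (rule absolutely_continuousI_density) measurable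
  have "AE z in \<beta>. ennreal (p z) = RN_deriv \<beta> \<alpha> z"
    by (rule \<beta>.RN_deriv_unique) (simp_all add: \<alpha>(1))
  then have ent: "AE z in \<beta>. entropy_density (exp 1) \<beta> \<alpha> z = ln (p z)"
  proof eventually_elim
    case (elim z)
    then have "enn2real (RN_deriv \<beta> \<alpha> z) = p z" using p0[of z] by (metis enn2real_ennreal)
    then show ?case by (simp add: entropy_density_def log_def)
  qed
  have int: "(\<integral>\<^sup>+ z. ennreal (g (entropy_density (exp 1) \<beta> \<alpha> z)) \<partial>\<alpha>) = (\<integral>\<^sup>+ z. ennreal (p z * max 0 (g (ln (p z)))) \<partial>\<beta>)"
    if [measurable]: "g \<in> borel_measurable borel" for g :: "real \<Rightarrow> real"
  proof -
    have "(\<integral>\<^sup>+ z. ennreal (g (entropy_density (exp 1) \<beta> \<alpha> z)) \<partial>\<alpha>)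
        = (\<integral>\<^sup>+ z. ennreal (p z) * ennreal (g (entropy_density (exp 1) \<beta> \<alpha> z)) \<partial>\<beta>)"
      by (subst nn_integral_density[symmetric], measurable) (simp add: \<alpha>(1)[symmetric])
    also have "\<dots> = (\<integral>\<^sup>+ z. ennreal (p z * max 0 (g (ln (p z)))) \<partial>\<beta>)"
      using ent by (intro nn_integral_cong_AE, eventually_elim)
        (auto simp: ennreal_mult p0 max_def ennreal_neg)
    finally show ?thesis .
  qed
  \<comment> \<open>integrals of the positive and the negative part of the log-density, the latter finite\<close>
  define a where "a = (\<integral>\<^sup>+ z. ennreal (p z * max 0 (ln (p z))) \<partial>\<beta>)"
  define b where "b = (\<integral>\<^sup>+ z. ennreal (p z * max 0 (- ln (p z))) \<partial>\<beta>)"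
  define I where "I = (\<integral>\<^sup>+ z. ennreal (kl_fun (p z)) \<partial>\<beta>)"
  have mass: "(\<integral>\<^sup>+ z. ennreal (p z) \<partial>\<beta>) = 1"
    using prob_space.emeasure_space_1[OF \<alpha>(2)] emeasure_density[of "\<lambda>z. ennreal (p z)" \<beta> "space \<beta>"]
    by (simp add: \<alpha>(1) cong: nn_integral_cong_simp)
  have "b \<le> (\<integral>\<^sup>+ z. 1 \<partial>\<beta>)"
    unfolding b_def
  proof (intro nn_integral_mono)
    fix z
    have "p z * max 0 (- ln (p z)) \<le> 1"
      using kl_fun_nonneg[OF p0[of z]] p0[of z] by (simp add: kl_fun_def max_def)
    then show "ennreal (p z * max 0 (- ln (p z))) \<le> 1" by simp
  qed
  then have b: "b < \<infinity>" by (auto simp: \<beta>.emeasure_space_1 intro: le_less_trans)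
  have "I + b + 1 = (\<integral>\<^sup>+ z. ennreal (kl_fun (p z)) + ennreal (p z * max 0 (- ln (p z))) + ennreal (p z) \<partial>\<beta>)"
    unfolding I_def b_def mass[symmetric] by (simp add: nn_integral_add)
  also have "\<dots> = (\<integral>\<^sup>+ z. ennreal (p z * max 0 (ln (p z))) + 1 \<partial>\<beta>)"
  proof (intro nn_integral_cong)
    fix z
    have "kl_fun (p z) + p z * max 0 (- ln (p z)) + p z = p z * max 0 (ln (p z)) + 1"
      by (simp add: kl_fun_def max_def)
    then have "ennreal (kl_fun (p z) + p z * max 0 (- ln (p z)) + p z) = ennreal (p z * max 0 (ln (p z)) + 1)" by simp
    then show "ennreal (kl_fun (p z)) + ennreal (p z * max 0 (- ln (p z))) + ennreal (p z) = ennreal (p z * max 0 (ln (p z))) + 1"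
      using p0[of z] kl_fun_nonneg[OF p0[of z]] by (simp add: ennreal_plus)
  qed
  also have "\<dots> = a + 1"
    unfolding a_def by (simp add: nn_integral_add \<beta>.emeasure_space_1)
  finally have "I + b = a" by (metis ennreal_add_diff_cancel_right ennreal_one_neq_top infinity_ennreal_def)
  then have "enn2ereal a - enn2ereal b = enn2ereal I"
    using b by (cases b; cases I) (auto simp: enn2ereal_ennreal simp flip: ennreal_plus)
  then show ?thesis
    using ac int[of "\<lambda>x. x"] int[of "\<lambda>x. - x"] by (simp add: D_KL_def a_def b_def I_def)
qed

lemma obtain_real_density:
  assumes \<beta>: "prob_space \<beta>" and \<alpha>: "prob_space \<alpha>" "sets \<alpha> = sets \<beta>" and ac: "absolutely_continuous \<beta> \<alpha>"
  obtains p :: "'a \<Rightarrow> real" where "p \<in> borel_measurable \<beta>" "\<And>z. 0 \<le> p z" "\<alpha> = density \<beta> (\<lambda>z. ennreal (p z))"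
proof -
  interpret \<beta>: prob_space \<beta> by (rule \<beta>)
  interpret \<alpha>: prob_space \<alpha> by (rule \<alpha>)
  show ?thesis
  proof (rule that)
    show "(\<lambda>z. enn2real (RN_deriv \<beta> \<alpha> z)) \<in> borel_measurable \<beta>" by measurable
    show "\<alpha> = density \<beta> (\<lambda>z. ennreal (enn2real (RN_deriv \<beta> \<alpha> z)))"
    proof -
      have "AE z in \<beta>. RN_deriv \<beta> \<alpha> z = ennreal (enn2real (RN_deriv \<beta> \<alpha> z))"
        using \<beta>.RN_deriv_finite[OF \<alpha>.sigma_finite_measure_axioms ac \<alpha>(2)]
        by eventually_elim (simp add: less_top)
      then have "density \<beta> (RN_deriv \<beta> \<alpha>) = density \<beta> (\<lambda>z. ennreal (enn2real (RN_deriv \<beta> \<alpha> z)))"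
        by (intro density_cong) auto
      then show ?thesis using \<beta>.density_RN_deriv[OF ac \<alpha>(2)] by simp
    qed
  qed simp
qed

lemma D_KL_nonneg:
  assumes \<beta>: "prob_space \<beta>" and \<alpha>: "prob_space \<alpha>" "sets \<alpha> = sets \<beta>"
  shows "0 \<le> D_KL \<alpha> \<beta>"
proof (cases "absolutely_continuous \<beta> \<alpha>")
  case True
  from obtain_real_density[OF \<beta> \<alpha> True] D_KL_density[OF \<beta>] \<alpha>(1) show ?thesis
    by (metis enn2ereal_nonneg)
qed (simp add: D_KL_def)

lemma integral_le_D_KL:
  assumes \<beta>: "prob_space \<beta>" and \<alpha>: "prob_space \<alpha>" "sets \<alpha> = sets \<beta>"
    and KL: "D_KL \<alpha> \<beta> \<le> ereal C"
    and f[measurable]: "f \<in> borel_measurable \<beta>" and B: "\<And>z. \<bar>f z\<bar> \<le> B"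
  shows "(\<integral>z. f z \<partial>\<alpha>) \<le> C + (\<integral>z. exp (f z) - 1 \<partial>\<beta>)"
proof -
  interpret \<beta>: prob_space \<beta> by (rule \<beta>)
  have "absolutely_continuous \<beta> \<alpha>" using KL by (auto simp: D_KL_def split: if_splits)
  from obtain_real_density[OF \<beta> \<alpha> this] obtain p
    where p[measurable]: "p \<in> borel_measurable \<beta>" and p0: "\<And>z. 0 \<le> p z"
      and dens: "\<alpha> = density \<beta> (\<lambda>z. ennreal (p z))" by blast
  have KL': "enn2ereal (\<integral>\<^sup>+ z. ennreal (kl_fun (p z)) \<partial>\<beta>) \<le> ereal C"
    using KL D_KL_density[OF \<beta> p p0 dens \<alpha>(1)] by simp
  then have C: "0 \<le> C" using enn2ereal_nonneg order_trans ereal_less_eq(5) by blast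
  have nn: "(\<integral>\<^sup>+ z. ennreal (kl_fun (p z)) \<partial>\<beta>) \<le> ennreal C"
    using KL' C by (simp add: less_eq_ennreal.rep_eq enn2ereal_ennreal)
  have int_kl: "integrable \<beta> (\<lambda>z. kl_fun (p z))"
    using nn p0 by (intro integrableI_nonneg) (auto simp: kl_fun_nonneg intro: le_less_trans)
  have kl: "(\<integral>z. kl_fun (p z) \<partial>\<beta>) \<le> C"
    using nn p0 C by (subst integral_eq_nn_integral) (auto simp: kl_fun_nonneg intro: enn2real_leI)
  have B0: "0 \<le> B" using B[of undefined] by linarith
  have "integrable \<alpha> f"
    using B by (intro finite_measure.integrable_const_bound[where B = B])
      (auto simp: dens prob_space.finite_measure[OF \<alpha>(1)[unfolded dens]])
  then have int_pf: "integrable \<beta> (\<lambda>z. p z * f z)"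
    unfolding dens using p0 by (subst (asm) integrable_density) auto
  have "\<bar>exp (f z) - 1\<bar> \<le> exp B + 1" for z
  proof -
    have "0 < exp (f z)" "exp (f z) \<le> exp B" using B[of z] by (auto simp: abs_le_iff)
    then show ?thesis by linarith
  qed
  then have int_e: "integrable \<beta> (\<lambda>z. exp (f z) - 1)"
    by (intro \<beta>.integrable_const_bound[where B = "exp B + 1"]) auto
  have "(\<integral>z. f z \<partial>\<alpha>) = (\<integral>z. p z * f z \<partial>\<beta>)"
    unfolding dens using p0 by (subst integral_density) auto
  also have "\<dots> \<le> (\<integral>z. kl_fun (p z) + (exp (f z) - 1) \<partial>\<beta>)"
  proof (intro integral_mono Bochner_Integration.integrable_add int_kl int_e int_pf)
    show "p z * f z \<le> kl_fun (p z) + (exp (f z) - 1)" for z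
      using kl_fun_young[OF p0, of z "f z"] by simp
  qed
  also have "\<dots> \<le> C + (\<integral>z. exp (f z) - 1 \<partial>\<beta>)"
    using kl int_kl int_e by (subst Bochner_Integration.integral_add) auto
  finally show ?thesis .
qed

lemma compact_open_sandwich:
  fixes M :: "'a::euclidean_space measure"
  assumes M: "sets M = sets borel" "finite_measure M" and A: "A \<in> sets borel" and e: "e > 0"
  obtains K U where "compact K" "open U" "K \<subseteq> A" "A \<subseteq> U" "measure M (U - K) < e"
proof -
  interpret finite_measure M by (rule M)
  have fin: "emeasure M (space M) \<noteq> \<infinity>" by simp
  have "emeasure M A < emeasure M A + ennreal (e/2)"
    using e by (simp add: emeasure_eq_measure ennreal_less_iff flip: ennreal_plus)
  then have "(INF U\<in>{U. A \<subseteq> U \<and> open U}. emeasure M U) < emeasure M A + ennreal (e/2)"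
    using outer_regular[OF M(1) fin A] by simp
  then obtain U where U: "A \<subseteq> U" "open U" "emeasure M U < emeasure M A + ennreal (e/2)"
    by (auto simp: INF_less_iff)
  have "\<exists>K. K \<subseteq> A \<and> compact K \<and> measure M A - e/2 < measure M K"
  proof (cases "measure M A - e/2 < 0")
    case True then show ?thesis by (intro exI[of _ "{}"]) simp
  next
    case False
    have "ennreal (measure M A - e/2) < emeasure M A"
      using e False by (simp add: emeasure_eq_measure ennreal_less_iff)
    then have "ennreal (measure M A - e/2) < (SUP K\<in>{K. K \<subseteq> A \<and> compact K}. emeasure M K)"
      using inner_regular[OF M(1) fin A] by simp
    then obtain K where "K \<subseteq> A" "compact K" "ennreal (measure M A - e/2) < emeasure M K"
      by (auto simp: less_SUP_iff)
    then show ?thesis using False by (intro exI[of _ K]) (simp add: emeasure_eq_measure ennreal_less_iff)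
  qed
  then obtain K where K: "K \<subseteq> A" "compact K" "measure M A - e/2 < measure M K" by blast
  have "measure M U < measure M A + e/2"
    using U(3) e by (simp add: emeasure_eq_measure ennreal_less_iff flip: ennreal_plus)
  moreover have "measure M (U - K) = measure M U - measure M K"
    using K U by (intro finite_measure_Diff) (auto simp: M(1) borel_compact)
  ultimately have "measure M (U - K) < e" using K(3) by linarith
  then show ?thesis using that K U by blast
qed

lemma urysohn_01:
  fixes K U :: "'a::euclidean_space set"
  assumes "compact K" "open U" "K \<subseteq> U"
  obtains h :: "'a \<Rightarrow> real" where "continuous_on UNIV h" "\<And>x. 0 \<le> h x" "\<And>x. h x \<le> 1"
    "\<And>x. x \<in> K \<Longrightarrow> h x = 1" "\<And>x. x \<notin> U \<Longrightarrow> h x = 0"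
proof -
  obtain h :: "'a \<Rightarrow> real" where "continuous_on UNIV h" "\<And>x. h x \<in> closed_segment 0 1"
    "\<And>x. x \<in> - U \<Longrightarrow> h x = 0" "\<And>x. x \<in> K \<Longrightarrow> h x = 1"
  proof (rule Urysohn[of "- U" K "0::real" 1])
    show "closed (- U)" "closed K" "- U \<inter> K = {}"
      using assms by (auto intro: compact_imp_closed closed_Compl)
  qed blast
  then show ?thesis using that by (auto simp: closed_segment_eq_real_ivl)
qed

lemma continuous_L1_dense:
  fixes M :: "'a::euclidean_space measure" and f :: "'a \<Rightarrow> real"
  assumes M: "sets M = sets borel" "finite_measure M" and f: "integrable M f" and "e > 0"
  shows "\<exists>g. continuous_on UNIV g \<and> bounded (range g) \<and> (\<integral>x. \<bar>f x - g x\<bar> \<partial>M) < e"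
proof -
  interpret finite_measure M by (rule M)
  have int_g: "integrable M g" if g: "continuous_on UNIV g" "bounded (range g)" for g :: "'a \<Rightarrow> real"
  proof -
    have "g \<in> borel_measurable M"
      using borel_measurable_continuous_onI[OF g(1)] M(1) by (simp cong: measurable_cong_sets)
    moreover obtain B where "\<And>x. norm (g x) \<le> B" using g(2) by (auto simp: bounded_iff)
    ultimately show ?thesis by (intro integrable_const_bound[where B = B]) auto
  qed
  let ?P = "\<lambda>f. \<forall>e>0. \<exists>g. continuous_on UNIV g \<and> bounded (range g) \<and> (\<integral>x. \<bar>f x - g x\<bar> \<partial>M) < e"
  have "?P f" using f
  proof (induction rule: integrable_induct)
    case (base A c)
    show ?case
    proof (intro allI impI)
      fix e :: real assume "e > 0"
      then have "e / (\<bar>c\<bar> + 1) > 0" by (simp add: add_nonneg_pos)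
      moreover have "A \<in> sets borel" using base M(1) by simp
      ultimately obtain K U where KU: "compact K" "open U" "K \<subseteq> A" "A \<subseteq> U" "measure M (U - K) < e / (\<bar>c\<bar> + 1)"
        using compact_open_sandwich[OF M] by metis
      obtain h :: "'a \<Rightarrow> real" where h: "continuous_on UNIV h" "\<And>x. 0 \<le> h x" "\<And>x. h x \<le> 1"
        "\<And>x. x \<in> K \<Longrightarrow> h x = 1" "\<And>x. x \<notin> U \<Longrightarrow> h x = 0"
        using urysohn_01[of K U] KU by blast
      have [measurable]: "U - K \<in> sets M" using KU by (auto simp: M(1) intro!: sets.Diff intro: borel_compact)
      have bd: "bounded (range (\<lambda>x. h x *\<^sub>R c))"
        using h(2,3) by (intro boundedI[where B = "\<bar>c\<bar>"]) (auto simp: abs_mult intro!: mult_left_le_one_le)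
      have cont: "continuous_on UNIV (\<lambda>x. h x *\<^sub>R c)" using h(1) by (intro continuous_intros)
      have "integrable M (\<lambda>x. indicator A x *\<^sub>R c - h x *\<^sub>R c)"
        using base int_g[OF cont bd] by (intro Bochner_Integration.integrable_diff) auto
      then have "(\<integral>x. \<bar>indicator A x *\<^sub>R c - h x *\<^sub>R c\<bar> \<partial>M) \<le> (\<integral>x. \<bar>c\<bar> * indicator (U - K) x \<partial>M)"
      proof (intro integral_mono integrable_abs)
        show "integrable M (\<lambda>x. \<bar>c\<bar> * indicator (U - K) x)"
          by (intro integrable_mult_right integrable_real_indicator) (auto simp: emeasure_eq_measure)
        fix x
        have "\<bar>indicator A x - h x\<bar> \<le> indicator (U - K) x"
          using h(2,3)[of x] h(4,5)[of x] KU(3,4) by (auto simp: indicator_def)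
        then have "\<bar>indicator A x - h x\<bar> * \<bar>c\<bar> \<le> indicator (U - K) x * \<bar>c\<bar>"
          by (intro mult_right_mono) auto
        moreover have "\<bar>indicator A x *\<^sub>R c - h x *\<^sub>R c\<bar> = \<bar>indicator A x - h x\<bar> * \<bar>c\<bar>"
          by (simp flip: abs_mult left_diff_distrib)
        ultimately show "\<bar>indicator A x *\<^sub>R c - h x *\<^sub>R c\<bar> \<le> \<bar>c\<bar> * indicator (U - K) x"
          by (simp add: mult.commute)
      qed auto
      also have "\<dots> = \<bar>c\<bar> * measure M (U - K)" by simp
      also have "\<dots> \<le> \<bar>c\<bar> * (e / (\<bar>c\<bar> + 1))" using KU(5) by (intro mult_left_mono) auto
      also have "\<dots> < e" using \<open>e > 0\<close> by (simp add: field_simps add_nonneg_pos)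
      finally show "\<exists>g. continuous_on UNIV g \<and> bounded (range g) \<and> (\<integral>x. \<bar>indicator A x *\<^sub>R c - g x\<bar> \<partial>M) < e"
        using cont bd by blast
    qed
  next
    case (add f1 f2)
    show ?case
    proof (intro allI impI)
      fix e :: real assume "e > 0"
      then obtain g1 g2 where g: "continuous_on UNIV g1" "bounded (range g1)" "(\<integral>x. \<bar>f1 x - g1 x\<bar> \<partial>M) < e/2"
        "continuous_on UNIV g2" "bounded (range g2)" "(\<integral>x. \<bar>f2 x - g2 x\<bar> \<partial>M) < e/2"
        using add.IH by (meson half_gt_zero)
      note int = add.hyps(1,2) int_g[OF g(1,2)] int_g[OF g(4,5)]
      have "(\<integral>x. \<bar>(f1 x + f2 x) - (g1 x + g2 x)\<bar> \<partial>M) \<le> (\<integral>x. \<bar>f1 x - g1 x\<bar> + \<bar>f2 x - g2 x\<bar> \<partial>M)"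
        using int by (intro integral_mono) auto
      also have "\<dots> = (\<integral>x. \<bar>f1 x - g1 x\<bar> \<partial>M) + (\<integral>x. \<bar>f2 x - g2 x\<bar> \<partial>M)"
        using int by (intro Bochner_Integration.integral_add) auto
      also have "\<dots> < e" using g by simp
      finally show "\<exists>g. continuous_on UNIV g \<and> bounded (range g) \<and> (\<integral>x. \<bar>f1 x + f2 x - g x\<bar> \<partial>M) < e"
        using g by (intro exI[of _ "\<lambda>x. g1 x + g2 x"]) (auto intro: continuous_intros bounded_plus_comp)
    qed
  next
    case (lim f s)
    show ?case
    proof (intro allI impI)
      fix e :: real assume "e > 0"
      have "(\<lambda>i. \<integral>x. \<bar>f x - s i x\<bar> \<partial>M) \<longlonglongrightarrow> (\<integral>x. 0 \<partial>M)"
      proof (rule integral_dominated_convergence[where w = "\<lambda>x. 3 * \<bar>f x\<bar>"])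
        show "AE x in M. (\<lambda>i. \<bar>f x - s i x\<bar>) \<longlonglongrightarrow> 0"
        proof (intro AE_I2)
          fix x assume "x \<in> space M"
          from tendsto_rabs[OF tendsto_diff[OF tendsto_const[of "f x"] lim.hyps(2)[OF this]]]
          show "(\<lambda>i. \<bar>f x - s i x\<bar>) \<longlonglongrightarrow> 0" by simp
        qed
        show "AE x in M. norm \<bar>f x - s i x\<bar> \<le> 3 * \<bar>f x\<bar>" for i
          using lim.hyps(3)[of _ i] by (intro AE_I2) fastforce
      qed (use lim.hyps in auto)
      then have "\<forall>\<^sub>F i in sequentially. (\<integral>x. \<bar>f x - s i x\<bar> \<partial>M) < e/2"
        by (rule order_tendstoD) (use \<open>e > 0\<close> in simp)
      then obtain i where i: "(\<integral>x. \<bar>f x - s i x\<bar> \<partial>M) < e/2"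
        using eventually_happens'[OF sequentially_bot] by blast
      obtain g where g: "continuous_on UNIV g" "bounded (range g)" "(\<integral>x. \<bar>s i x - g x\<bar> \<partial>M) < e/2"
        using lim.IH[of i] \<open>e > 0\<close> by (meson half_gt_zero)
      note int = lim.hyps(4) lim.hyps(1)[of i] int_g[OF g(1,2)]
      have "(\<integral>x. \<bar>f x - g x\<bar> \<partial>M) \<le> (\<integral>x. \<bar>f x - s i x\<bar> + \<bar>s i x - g x\<bar> \<partial>M)"
        using int by (intro integral_mono) auto
      also have "\<dots> = (\<integral>x. \<bar>f x - s i x\<bar> \<partial>M) + (\<integral>x. \<bar>s i x - g x\<bar> \<partial>M)"
        using int by (intro Bochner_Integration.integral_add) auto
      also have "\<dots> < e" using g i by simp
      finally show "\<exists>g. continuous_on UNIV g \<and> bounded (range g) \<and> (\<integral>x. \<bar>f x - g x\<bar> \<partial>M) < e"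
        using g by blast
    qed
  qed
  then show ?thesis using \<open>e > 0\<close> by blast
qed

lemma bounded_measurable_AE_limit_continuous:
  fixes M :: "'a::euclidean_space measure" and f :: "'a \<Rightarrow> real"
  assumes M: "sets M = sets borel" "finite_measure M"
    and f[measurable]: "f \<in> borel_measurable M" and B: "\<And>x. \<bar>f x\<bar> \<le> B"
  obtains g where "\<And>n::nat. continuous_on UNIV (g n)" "\<And>n x. \<bar>g n x\<bar> \<le> B" "AE x in M. (\<lambda>n. g n x) \<longlonglongrightarrow> f x"
proof -
  interpret finite_measure M by (rule M)
  have int_f: "integrable M f" using B by (intro integrable_const_bound[where B = B]) auto
  have "\<exists>g. continuous_on UNIV g \<and> bounded (range g) \<and> (\<integral>x. \<bar>f x - g x\<bar> \<partial>M) < 1 / real (Suc n)" for n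
    using continuous_L1_dense[OF M int_f] by simp
  then obtain g where g: "\<And>n. continuous_on UNIV (g n)" "\<And>n. bounded (range (g n))"
      "\<And>n. (\<integral>x. \<bar>f x - g n x\<bar> \<partial>M) < 1 / real (Suc n)" by metis
  have gm[measurable]: "g n \<in> borel_measurable M" for n
    using borel_measurable_continuous_onI[OF g(1)] M(1) by (simp cong: measurable_cong_sets)
  have int_g: "integrable M (g n)" for n
  proof -
    obtain C where "\<And>x. norm (g n x) \<le> C" using g(2)[of n] by (auto simp: bounded_iff)
    then show ?thesis by (intro integrable_const_bound[where B = C]) auto
  qed
  have "(\<integral>x. \<bar>f x - g n x\<bar> \<partial>M) \<le> inverse (real (Suc n))" for n
    using g(3)[of n] by (simp add: inverse_eq_divide)
  then have "(\<lambda>n. \<integral>x. \<bar>f x - g n x\<bar> \<partial>M) \<longlonglongrightarrow> 0"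
    by (intro tendsto_sandwich[OF _ _ tendsto_const LIMSEQ_inverse_real_of_nat]) auto
  then obtain r :: "nat \<Rightarrow> nat" where "strict_mono r" and r: "AE x in M. (\<lambda>n. f x - g (r n) x) \<longlonglongrightarrow> 0"
    using tendsto_L1_AE_subseq[of M "\<lambda>n x. f x - g n x"] int_f int_g by auto
  show ?thesis
  proof (rule that[of "\<lambda>n x. max (- B) (min B (g (r n) x))"])
    have B0: "0 \<le> B" using B[of undefined] by linarith
    show "continuous_on UNIV (\<lambda>x. max (- B) (min B (g (r n) x)))" for n
      using g(1) by (intro continuous_intros)
    show "\<bar>max (- B) (min B (g (r n) x))\<bar> \<le> B" for n x using B0 by (simp add: abs_le_iff)
    show "AE x in M. (\<lambda>n. max (- B) (min B (g (r n) x))) \<longlonglongrightarrow> f x"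
      using r
    proof eventually_elim
      case (elim x)
      from tendsto_diff[OF tendsto_const[of "f x"] elim]
      have "(\<lambda>n. g (r n) x) \<longlonglongrightarrow> f x" by simp
      then have "(\<lambda>n. max (- B) (min B (g (r n) x))) \<longlonglongrightarrow> max (- B) (min B (f x))"
        by (intro tendsto_intros)
      moreover have "max (- B) (min B (f x)) = f x" using B[of x] by (simp add: abs_le_iff max_def min_def)
      ultimately show ?case by simp
    qed
  qed
qed

text \<open>
  If \<open>A\<close> is \<open>\<beta>\<close>-null but not \<open>\<alpha>\<close>-null, test functions close to \<open>n\<close> times the indicator of \<open>A\<close>
  violate the bound for large \<open>n\<close>.
\<close>

lemma absolutely_continuous_if_duality_bound:
  fixes \<alpha> \<beta> :: "'a::euclidean_space measure"
  assumes \<beta>: "sets \<beta> = sets borel" "prob_space \<beta>" and \<alpha>: "sets \<alpha> = sets borel" "prob_space \<alpha>"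
    and bound: "\<And>f :: 'a \<Rightarrow> real. continuous_on UNIV f \<Longrightarrow> bounded (range f) \<Longrightarrow>
      (\<integral>z. f z \<partial>\<alpha>) \<le> C + (\<integral>z. exp (f z) - 1 \<partial>\<beta>)"
  shows "absolutely_continuous \<beta> \<alpha>"
  unfolding absolutely_continuous_def
proof
  interpret \<alpha>: prob_space \<alpha> by (rule \<alpha>)
  interpret \<beta>: prob_space \<beta> by (rule \<beta>)
  fix A assume "A \<in> null_sets \<beta>"
  then have A: "A \<in> sets borel" "measure \<beta> A = 0" using \<beta>(1) by (auto simp: null_sets_def measure_def)
  have "measure \<alpha> A \<le> 0"
  proof (rule ccontr)
    assume "\<not> measure \<alpha> A \<le> 0"
    then have a: "measure \<alpha> A / 2 > 0" by simp
    obtain n :: nat where n: "C + 1 < real n * (measure \<alpha> A / 2)"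
      using ex_less_of_nat_mult[OF a] by blast
    obtain K U' where K: "compact K" "open U'" "K \<subseteq> A" "A \<subseteq> U'" "measure \<alpha> (U' - K) < measure \<alpha> A / 2"
      using compact_open_sandwich[OF \<alpha>(1) \<alpha>.finite_measure_axioms A(1) a] by blast
    \<comment> \<open>the tolerance exp (-n) compensates the factor exp n on the right-hand side of the bound\<close>
    obtain K' U where U: "compact K'" "open U" "K' \<subseteq> A" "A \<subseteq> U" "measure \<beta> (U - K') < exp (- real n)"
      using compact_open_sandwich[OF \<beta>(1) \<beta>.finite_measure_axioms A(1), of "exp (- real n)"] by auto
    obtain h :: "'a \<Rightarrow> real" where h: "continuous_on UNIV h" "\<And>x. 0 \<le> h x" "\<And>x. h x \<le> 1"
      "\<And>x. x \<in> K \<Longrightarrow> h x = 1" "\<And>x. x \<notin> U \<Longrightarrow> h x = 0"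
      using urysohn_01[of K U] K U by blast
    have hb: "h \<in> borel_measurable borel" using h(1) by (rule borel_measurable_continuous_onI)
    have [measurable]: "h \<in> borel_measurable \<alpha>" "h \<in> borel_measurable \<beta>"
      using hb \<alpha>(1) \<beta>(1) by (simp_all cong: measurable_cong_sets)
    have sets[measurable]: "K \<in> sets \<alpha>" "U \<in> sets \<beta>" "K' \<in> sets \<beta>" "A \<in> sets \<alpha>" "A \<in> sets \<beta>"
      using K U A by (auto simp: \<alpha>(1) \<beta>(1) borel_compact)
    have "measure \<alpha> A \<le> measure \<alpha> K + measure \<alpha> (U' - K)"
    proof -
      have "U' \<in> sets \<alpha>" using K(2) \<alpha>(1) by simp
      have "U' - K \<in> sets \<alpha>" using K by (auto simp: \<alpha>(1) intro!: sets.Diff intro: borel_compact)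
      moreover from this have "measure \<alpha> A \<le> measure \<alpha> (K \<union> (U' - K))"
        using K sets(1) \<open>U' \<in> sets \<alpha>\<close> by (intro \<alpha>.finite_measure_mono) auto
      ultimately show ?thesis
        using measure_Un_le[of K \<alpha> "U' - K"] by simp
    qed
    then have "measure \<alpha> A / 2 \<le> measure \<alpha> K" using K(5) by linarith
    then have "real n * (measure \<alpha> A / 2) \<le> real n * measure \<alpha> K" by (intro mult_left_mono) auto
    also have "\<dots> = (\<integral>z. real n * indicator K z \<partial>\<alpha>)" by simp
    also have "\<dots> \<le> (\<integral>z. real n * h z \<partial>\<alpha>)"
    proof (intro integral_mono)
      show "integrable \<alpha> (\<lambda>z. real n * indicator K z)"
        by (intro integrable_mult_right integrable_real_indicator) (auto simp: \<alpha>.emeasure_eq_measure)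
      show "integrable \<alpha> (\<lambda>z. real n * h z)"
        using h(2,3) by (intro \<alpha>.integrable_const_bound[where B = "real n"]) (auto intro!: AE_I2 mult_left_le)
      show "real n * indicator K z \<le> real n * h z" for z
        using h(2,4)[of z] by (auto simp: indicator_def)
    qed
    also have "\<dots> \<le> C + (\<integral>z. exp (real n * h z) - 1 \<partial>\<beta>)"
      using h by (intro bound continuous_intros boundedI[where B = "real n"]) (auto intro!: mult_left_le)
    also have "(\<integral>z. exp (real n * h z) - 1 \<partial>\<beta>) \<le> (\<integral>z. exp (real n) * indicator U z \<partial>\<beta>)"
    proof (intro integral_mono)
      have le: "exp (real n * h z) \<le> exp (real n)" for z
        using h(2,3) by (auto intro!: mult_left_le)
      have "\<bar>exp (real n * h z) - 1\<bar> \<le> exp (real n)" for z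
      proof -
        have "1 \<le> exp (real n * h z)" using h(2)[of z] by simp
        then show ?thesis using le[of z] by linarith
      qed
      then show "integrable \<beta> (\<lambda>z. exp (real n * h z) - 1)"
        by (intro \<beta>.integrable_const_bound[where B = "exp (real n)"]) auto
      show "exp (real n * h z) - 1 \<le> exp (real n) * indicator U z" for z
      proof -
        have "exp (real n * h z) - 1 \<le> exp (real n)" using le[of z] by linarith
        then show ?thesis using h(5)[of z] by (cases "z \<in> U") auto
      qed
      show "integrable \<beta> (\<lambda>z. exp (real n) * indicator U z)"
        by (intro integrable_mult_right integrable_real_indicator) (auto simp: \<beta>.emeasure_eq_measure)
    qed
    also have "\<dots> = exp (real n) * measure \<beta> U" by simp
    also have "measure \<beta> U \<le> measure \<beta> A + measure \<beta> (U - K')"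
    proof -
      have "measure \<beta> U \<le> measure \<beta> (A \<union> (U - K'))"
        using U(3) by (intro \<beta>.finite_measure_mono) auto
      also have "\<dots> \<le> measure \<beta> A + measure \<beta> (U - K')" by (intro measure_Un_le) auto
      finally show ?thesis .
    qed
    then have "exp (real n) * measure \<beta> U \<le> exp (real n) * exp (- real n)"
      using U(5) A(2) by (intro mult_left_mono) auto
    also have "exp (real n) * exp (- real n) = 1" by (simp flip: exp_add)
    finally show False using n by linarith
  qed
  then have "measure \<alpha> A = 0" using measure_nonneg[of \<alpha> A] by linarith
  then show "A \<in> null_sets \<alpha>"
    using A(1) by (intro null_setsI) (auto simp: \<alpha>.emeasure_eq_measure \<alpha>(1))
qed

text \<open>
  The optimal test function is \<open>ln p\<close> with \<open>p\<close> the density.  It is truncated to be bounded, and the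
  bound, which extends from bounded continuous to bounded measurable functions by dominated
  convergence, is applied to the truncations.
\<close>

lemma D_KL_le_if_duality_bound:
  fixes \<alpha> \<beta> :: "'a::euclidean_space measure"
  assumes \<beta>: "sets \<beta> = sets borel" "prob_space \<beta>" and \<alpha>: "sets \<alpha> = sets borel" "prob_space \<alpha>"
    and C: "0 \<le> C"
    and bound: "\<And>f :: 'a \<Rightarrow> real. continuous_on UNIV f \<Longrightarrow> bounded (range f) \<Longrightarrow>
      (\<integral>z. f z \<partial>\<alpha>) \<le> C + (\<integral>z. exp (f z) - 1 \<partial>\<beta>)"
  shows "D_KL \<alpha> \<beta> \<le> ereal C"
proof -
  interpret \<alpha>: prob_space \<alpha> by (rule \<alpha>)
  interpret \<beta>: prob_space \<beta> by (rule \<beta>)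
  have ac: "absolutely_continuous \<beta> \<alpha>"
    by (rule absolutely_continuous_if_duality_bound[OF \<beta> \<alpha> bound])
  have sets_eq: "sets \<alpha> = sets \<beta>" using \<alpha> \<beta> by simp
  from obtain_real_density[OF \<beta>(2) \<alpha>(2) sets_eq ac] obtain p
    where p[measurable]: "p \<in> borel_measurable \<beta>" and p0: "\<And>z. 0 \<le> p z"
      and dens: "\<alpha> = density \<beta> (\<lambda>z. ennreal (p z))" by blast
  have measurable_eq: "borel_measurable \<alpha> = borel_measurable \<beta>"
    using sets_eq by (simp cong: measurable_cong_sets)
  \<comment> \<open>extension of the bound to bounded measurable test functions\<close>
  have bound': "(\<integral>z. f z \<partial>\<alpha>) \<le> C + (\<integral>z. exp (f z) - 1 \<partial>\<beta>)"
    if f[measurable]: "f \<in> borel_measurable \<beta>" and B: "\<And>z. \<bar>f z\<bar> \<le> B" for f B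
  proof -
    obtain g where g: "\<And>n::nat. continuous_on UNIV (g n)" "\<And>n x. \<bar>g n x\<bar> \<le> B"
      and lim: "AE x in \<beta>. (\<lambda>n. g n x) \<longlonglongrightarrow> f x"
      using bounded_measurable_AE_limit_continuous[OF \<beta>(1) \<beta>.finite_measure_axioms f B] by blast
    have lim': "AE x in \<alpha>. (\<lambda>n. g n x) \<longlonglongrightarrow> f x"
      using absolutely_continuous_AE[OF sets_eq ac lim] .
    have gm[measurable]: "g n \<in> borel_measurable \<beta>" for n
      using borel_measurable_continuous_onI[OF g(1)] \<beta>(1) by (simp cong: measurable_cong_sets)
    have gm'[measurable]: "g n \<in> borel_measurable \<alpha>" "f \<in> borel_measurable \<alpha>" for n
      using gm f by (simp_all add: measurable_eq)
    have L: "(\<lambda>n. \<integral>z. g n z \<partial>\<alpha>) \<longlonglongrightarrow> (\<integral>z. f z \<partial>\<alpha>)"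
      using lim' g(2) by (intro integral_dominated_convergence[where w = "\<lambda>_. B"]) auto
    have R: "(\<lambda>n. \<integral>z. exp (g n z) - 1 \<partial>\<beta>) \<longlonglongrightarrow> (\<integral>z. exp (f z) - 1 \<partial>\<beta>)"
    proof (intro integral_dominated_convergence[where w = "\<lambda>_. exp B + 1"])
      show "AE z in \<beta>. (\<lambda>n. exp (g n z) - 1) \<longlonglongrightarrow> exp (f z) - 1"
        using lim by eventually_elim (intro tendsto_intros)
      have "norm (exp (g n z) - 1) \<le> exp B + 1" for n z
      proof -
        have "0 < exp (g n z)" "exp (g n z) \<le> exp B" using g(2)[of n z] by (auto simp: abs_le_iff)
        then show ?thesis unfolding real_norm_def by linarith
      qed
      then show "AE z in \<beta>. norm (exp (g n z) - 1) \<le> exp B + 1" for n by simp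
    qed auto
    have "(\<integral>z. g n z \<partial>\<alpha>) \<le> C + (\<integral>z. exp (g n z) - 1 \<partial>\<beta>)" for n
      using g by (intro bound boundedI[where B = B]) auto
    then show ?thesis
      by (intro LIMSEQ_le[OF L tendsto_add[OF tendsto_const R]]) auto
  qed
  \<comment> \<open>truncation of the density to [1/(n+1), n+1]\<close>
  define q where "q n t = max (1 / real (Suc n)) (min (real (Suc n)) t)" for n t
  have q_pos: "0 < q n t" for n t by (simp add: q_def less_max_iff_disj)
  have q_ge: "1 / real (Suc n) \<le> q n t" and q_le: "q n t \<le> real (Suc n)" for n t
    by (auto simp: q_def field_simps)
  define \<phi> where "\<phi> n t = t * ln (q n t) - q n t + 1" for n t
  have \<phi>_nonneg: "0 \<le> \<phi> n t" if "0 \<le> t" for n t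
  proof -
    consider "t \<le> 1 / real (Suc n)" | "real (Suc n) \<le> t" | "1 / real (Suc n) \<le> t" "t \<le> real (Suc n)" by linarith
    \<comment> \<open>the sign of ln (q n t) is favourable wherever the truncation is active\<close>
    then have "kl_fun (q n t) \<le> \<phi> n t"
    proof cases
      case 1
      moreover have "1 / real (Suc n) \<le> real (Suc n)" by (simp add: field_simps)
      ultimately have q: "q n t = 1 / real (Suc n)" by (simp add: q_def)
      have "ln (q n t) \<le> 0" unfolding q by (simp add: ln_div)
      then have "q n t * ln (q n t) \<le> t * ln (q n t)" using 1 q by (intro mult_right_mono_neg) auto
      then show ?thesis by (simp add: \<phi>_def kl_fun_def)
    next
      case 2
      moreover have "1 / real (Suc n) \<le> real (Suc n)" by (simp add: field_simps)
      ultimately have q: "q n t = real (Suc n)" by (simp add: q_def)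
      have "0 \<le> ln (q n t)" unfolding q by simp
      then have "q n t * ln (q n t) \<le> t * ln (q n t)" using 2 q by (intro mult_right_mono) auto
      then show ?thesis by (simp add: \<phi>_def kl_fun_def)
    next
      case 3
      then have "q n t = t" by (simp add: q_def)
      then show ?thesis by (simp add: \<phi>_def kl_fun_def)
    qed
    then show ?thesis using kl_fun_nonneg[of "q n t"] q_pos[of n t] by linarith
  qed
  have qm[measurable]: "(\<lambda>z. q n (p z)) \<in> borel_measurable \<beta>" for n unfolding q_def by measurable
  have \<phi>m[measurable]: "(\<lambda>z. \<phi> n (p z)) \<in> borel_measurable \<beta>" for n unfolding \<phi>_def by measurable
  have le: "(\<integral>\<^sup>+ z. ennreal (\<phi> n (p z)) \<partial>\<beta>) \<le> ennreal C" for n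
  proof -
    let ?f = "\<lambda>z. ln (q n (p z))"
    have b: "\<bar>?f z\<bar> \<le> ln (real (Suc n))" for z
    proof -
      have "ln (q n (p z)) \<le> ln (real (Suc n))" using q_le q_pos by simp
      moreover have "ln (1 / real (Suc n)) \<le> ln (q n (p z))" using q_ge q_pos by (subst ln_le_cancel_iff) auto
      ultimately show ?thesis by (simp add: abs_le_iff ln_div)
    qed
    have fm: "?f \<in> borel_measurable \<beta>" by measurable
    have "integrable \<alpha> ?f"
      using b fm by (intro \<alpha>.integrable_const_bound[where B = "ln (real (Suc n))"]) (auto simp: measurable_eq)
    then have i1: "integrable \<beta> (\<lambda>z. p z * ?f z)"
      unfolding dens using p0 by (subst (asm) integrable_density) auto
    have i2: "integrable \<beta> (\<lambda>z. exp (?f z) - 1)"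
      using q_pos q_le by (intro Bochner_Integration.integrable_diff \<beta>.integrable_const_bound[where B = "real (Suc n)"])
        (auto simp: less_imp_le[OF q_pos])
    have "(\<integral>z. p z * ?f z \<partial>\<beta>) = (\<integral>z. ?f z \<partial>\<alpha>)"
      unfolding dens using p0 by (subst integral_density) auto
    also have "\<dots> \<le> C + (\<integral>z. exp (?f z) - 1 \<partial>\<beta>)"
      by (rule bound'[OF fm b])
    finally have "(\<integral>z. p z * ?f z - (exp (?f z) - 1) \<partial>\<beta>) \<le> C"
      using i1 i2 by (subst Bochner_Integration.integral_diff) auto
    moreover have eq: "p z * ?f z - (exp (?f z) - 1) = \<phi> n (p z)" for z
      using q_pos[of n "p z"] by (simp add: \<phi>_def)
    ultimately have "(\<integral>z. \<phi> n (p z) \<partial>\<beta>) \<le> C" by simp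
    moreover have "integrable \<beta> (\<lambda>z. \<phi> n (p z))"
      using Bochner_Integration.integrable_diff[OF i1 i2] unfolding eq .
    ultimately show ?thesis
      using \<phi>_nonneg[OF p0] by (subst nn_integral_eq_integral) (auto intro: ennreal_leI)
  qed
  have lim: "(\<lambda>n. \<phi> n t) \<longlonglongrightarrow> kl_fun t" if "0 \<le> t" for t
  proof (cases "t = 0")
    case True
    have "\<phi> n t = 1 - inverse (real (Suc n))" for n
      using True by (simp add: \<phi>_def q_def max_def inverse_eq_divide)
    then show ?thesis
      using tendsto_diff[OF tendsto_const LIMSEQ_inverse_real_of_nat, of 1] True by (simp add: kl_fun_def)
  next
    case False
    with that have t: "t > 0" by simp
    obtain N1 :: nat where N1: "t < real N1" using reals_Archimedean2 by blast
    obtain N2 :: nat where N2: "inverse t < real N2" using reals_Archimedean2 by blast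
    have "\<phi> n t = kl_fun t" if "n \<ge> max N1 N2" for n
    proof -
      have "1 / real (Suc n) \<le> t"
      proof -
        have "inverse t \<le> real (Suc n)" using N2 that by linarith
        then show ?thesis using t by (simp add: field_simps)
      qed
      moreover have "t \<le> real (Suc n)" using N1 that by linarith
      ultimately have "q n t = t" by (simp add: q_def)
      then show ?thesis by (simp add: \<phi>_def kl_fun_def)
    qed
    then have "\<forall>\<^sub>F n in sequentially. \<phi> n t = kl_fun t"
      unfolding eventually_sequentially by blast
    then show ?thesis by (rule tendsto_eventually)
  qed
  have "(\<integral>\<^sup>+ z. ennreal (kl_fun (p z)) \<partial>\<beta>) = (\<integral>\<^sup>+ z. liminf (\<lambda>n. ennreal (\<phi> n (p z))) \<partial>\<beta>)"
    using lim[OF p0] by (intro nn_integral_cong lim_imp_Liminf[symmetric]) auto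
  also have "\<dots> \<le> liminf (\<lambda>n. \<integral>\<^sup>+ z. ennreal (\<phi> n (p z)) \<partial>\<beta>)"
    by (rule nn_integral_liminf) measurable
  also have "\<dots> \<le> ennreal C"
    using le by (intro Liminf_le) auto
  finally show ?thesis
    using C unfolding D_KL_density[OF \<beta>(2) p p0 dens \<alpha>(2)]
    by (simp add: less_eq_ennreal.rep_eq enn2ereal_ennreal)
qed

lemma D_KL_weak_limit_le:
  fixes \<beta> :: "'a::euclidean_space measure"
  assumes \<beta>: "sets \<beta> = sets borel" "prob_space \<beta>" and \<alpha>: "sets \<alpha> = sets borel" "prob_space \<alpha>"
    and \<alpha>s: "\<And>k. sets (\<alpha>s k) = sets borel" "\<And>k. prob_space (\<alpha>s k)"
    and conv: "weakly_converges \<alpha>s \<alpha>" and C: "0 \<le> C"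
    and KL: "\<forall>\<^sub>F k in sequentially. D_KL (\<alpha>s k) \<beta> \<le> ereal C"
  shows "D_KL \<alpha> \<beta> \<le> ereal C"
proof (rule D_KL_le_if_duality_bound[OF \<beta> \<alpha> C])
  fix f :: "'a \<Rightarrow> real" assume f: "continuous_on UNIV f" "bounded (range f)"
  have fm: "f \<in> borel_measurable \<beta>"
    using borel_measurable_continuous_onI[OF f(1)] \<beta>(1) by (simp cong: measurable_cong_sets)
  obtain B where B: "\<And>z. \<bar>f z\<bar> \<le> B" using f(2) by (auto simp: bounded_iff)
  have "(\<lambda>k. \<integral>z. f z \<partial>\<alpha>s k) \<longlonglongrightarrow> (\<integral>z. f z \<partial>\<alpha>)"
    using conv f by (simp add: weakly_converges_def)
  then show "(\<integral>z. f z \<partial>\<alpha>) \<le> C + (\<integral>z. exp (f z) - 1 \<partial>\<beta>)"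
  proof (rule tendsto_upperbound)
    show "\<forall>\<^sub>F k in sequentially. (\<integral>z. f z \<partial>\<alpha>s k) \<le> C + (\<integral>z. exp (f z) - 1 \<partial>\<beta>)"
      using KL by eventually_elim (rule integral_le_D_KL[OF \<beta>(2) \<alpha>s(2) _ _ fm B], auto simp: \<alpha>s(1) \<beta>(1))
  qed simp
qed

section \<open>Approximation by couplings of finite divergence\<close>

text \<open>
  Marginals of a block coupling: \<open>P\<close> is a matrix with row sums \<open>m\<close> and column sums \<open>n\<close>, and \<open>x i\<close> is
  the mass of the part of block \<open>i\<close> that is tested.  Blocks of mass zero contribute nothing, in
  agreement with division by zero yielding zero.
\<close>

lemma sum_block_weights:
  fixes P :: "'i \<Rightarrow> 'j \<Rightarrow> real"
  assumes fin: "finite I" "finite J" and P: "\<And>i j. 0 \<le> P i j"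
    and m: "\<And>i. i \<in> I \<Longrightarrow> (\<Sum>j\<in>J. P i j) = m i" and n: "\<And>j. j \<in> J \<Longrightarrow> (\<Sum>i\<in>I. P i j) = n j"
    and x: "\<And>i. i \<in> I \<Longrightarrow> m i = 0 \<Longrightarrow> x i = 0"
  shows "(\<Sum>i\<in>I. \<Sum>j\<in>J. P i j / (m i * n j) * (x i * n j)) = (\<Sum>i\<in>I. x i)"
proof (intro sum.cong refl)
  fix i assume i: "i \<in> I"
  have "P i j / (m i * n j) * (x i * n j) = P i j * (x i / m i)" if j: "j \<in> J" for j
  proof (cases "n j = 0")
    case True
    then have "(\<Sum>i\<in>I. P i j) = 0" using n[OF j] by simp
    then have "P i j = 0" using fin P i by (simp add: sum_nonneg_eq_0_iff)
    then show ?thesis by simp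
  qed simp
  then have "(\<Sum>j\<in>J. P i j / (m i * n j) * (x i * n j)) = (\<Sum>j\<in>J. P i j) * (x i / m i)"
    unfolding sum_distrib_right by (intro sum.cong refl)
  also have "\<dots> = x i" using m[OF i] x[OF i] by auto
  finally show "(\<Sum>j\<in>J. P i j / (m i * n j) * (x i * n j)) = x i" .
qed

text \<open>
  For finite partitions of both factors (the fibres of \<open>T\<close> and \<open>S\<close>) there is a coupling which gives
  every product block the same mass as \<open>\<pi>\<close> and is, on each block, a multiple of \<open>\<mu> \<Otimes>\<^sub>M \<nu>\<close>.  Its
  density is bounded, so its divergence is finite.
\<close>

lemma block_coupling:
  fixes \<mu> :: "'a::euclidean_space measure" and \<nu> :: "'b::euclidean_space measure"
    and T :: "'a \<Rightarrow> 'c" and S :: "'b \<Rightarrow> 'd"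
  assumes \<mu>: "sets \<mu> = sets borel" "prob_space \<mu>" and \<nu>: "sets \<nu> = sets borel" "prob_space \<nu>"
    and \<pi>: "\<pi> \<in> couplings \<mu> \<nu>" and T: "simple_function borel T" and S: "simple_function borel S"
  shows "\<exists>\<rho>\<in>couplings \<mu> \<nu>. D_KL \<rho> (\<mu> \<Otimes>\<^sub>M \<nu>) < \<infinity> \<and>
    (\<forall>g :: 'c \<times> 'd \<Rightarrow> real. (\<integral>z. g (T (fst z), S (snd z)) \<partial>\<rho>) = (\<integral>z. g (T (fst z), S (snd z)) \<partial>\<pi>))"
proof -
  note c = couplingsD[OF \<pi>]
  interpret \<mu>: prob_space \<mu> by (rule \<mu>)
  interpret \<nu>: prob_space \<nu> by (rule \<nu>)
  interpret \<pi>: prob_space \<pi> by (rule c)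
  interpret pair_prob_space \<mu> \<nu> ..
  let ?\<beta> = "\<mu> \<Otimes>\<^sub>M \<nu>"
  have sets_\<beta>: "sets ?\<beta> = sets borel"
    using sets_pair_measure_cong[OF \<mu>(1) \<nu>(1)] unfolding borel_prod .
  have space: "space \<mu> = UNIV" "space \<nu> = UNIV" "space ?\<beta> = UNIV"
    using sets_eq_imp_space_eq[OF \<mu>(1)] sets_eq_imp_space_eq[OF \<nu>(1)] sets_eq_imp_space_eq[OF sets_\<beta>] by auto
  define I where "I = range T"
  define J where "J = range S"
  have fin: "finite I" "finite J" using T S by (auto simp: I_def J_def simple_function_def)
  define A where "A i = T -` {i}" for i
  define B where "B j = S -` {j}" for j
  have A: "A i \<in> sets borel" for i using simple_functionD(2)[OF T, of "{i}"] by (simp add: A_def)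
  have B: "B j \<in> sets borel" for j using simple_functionD(2)[OF S, of "{j}"] by (simp add: B_def)
  have rect: "X \<times> Y \<in> sets borel" if "X \<in> sets borel" "Y \<in> sets borel" for X :: "'a set" and Y :: "'b set"
    using pair_measureI[OF that] unfolding borel_prod .
  define P where "P i j = measure \<pi> (A i \<times> B j)" for i j
  define m where "m i = measure \<mu> (A i)" for i
  define n where "n j = measure \<nu> (B j)" for j
  define w where "w i j = P i j / (m i * n j)" for i j
  have w0: "0 \<le> w i j" for i j by (simp add: w_def P_def m_def n_def)
  have UA: "(\<Union>i\<in>I. A i) = UNIV" and UB: "(\<Union>j\<in>J. B j) = UNIV" by (auto simp: I_def J_def A_def B_def)
  have sum_m: "(\<Sum>j\<in>J. P i j) = m i" for i
  proof -
    have "(\<Sum>j\<in>J. P i j) = measure \<pi> (\<Union>j\<in>J. A i \<times> B j)"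
      unfolding P_def using A B fin rect
      by (intro \<pi>.finite_measure_finite_Union[symmetric]) (auto simp: c(1) disjoint_family_on_def B_def)
    also have "(\<Union>j\<in>J. A i \<times> B j) = fst -` A i \<inter> space \<pi>" using c(7) by (auto simp: J_def B_def)
    also have "measure \<pi> \<dots> = m i"
      unfolding m_def c(3)[symmetric] using A c(5) by (simp add: measure_distr)
    finally show ?thesis .
  qed
  have sum_n: "(\<Sum>i\<in>I. P i j) = n j" for j
  proof -
    have "(\<Sum>i\<in>I. P i j) = measure \<pi> (\<Union>i\<in>I. A i \<times> B j)"
      unfolding P_def using A B fin rect
      by (intro \<pi>.finite_measure_finite_Union[symmetric]) (auto simp: c(1) disjoint_family_on_def A_def)
    also have "(\<Union>i\<in>I. A i \<times> B j) = snd -` B j \<inter> space \<pi>" using c(7) by (auto simp: I_def A_def)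
    also have "measure \<pi> \<dots> = n j"
      unfolding n_def c(4)[symmetric] using B c(6) by (simp add: measure_distr)
    finally show ?thesis .
  qed
  define p where "p z = w (T (fst z)) (S (snd z))" for z
  have p_sum: "p z = (\<Sum>i\<in>I. \<Sum>j\<in>J. w i j * indicator (A i \<times> B j) z)" for z
  proof -
    have "(\<Sum>i\<in>I. \<Sum>j\<in>J. w i j * indicator (A i \<times> B j) z)
        = (\<Sum>i\<in>I. if i = T (fst z) then (\<Sum>j\<in>J. if j = S (snd z) then w i j else 0) else 0)"
      by (intro sum.cong refl) (auto simp: A_def B_def indicator_def mem_Times_iff intro!: sum.cong sum.neutral)
    also have "\<dots> = p z" using fin by (simp add: p_def I_def J_def)
    finally show ?thesis by simp
  qed
  have p0: "0 \<le> p z" for z by (simp add: p_def w0)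
  have "p \<in> borel_measurable borel"
    unfolding p_sum using rect[OF A B] by measurable
  then have p[measurable]: "p \<in> borel_measurable ?\<beta>"
    using sets_\<beta> by (simp cong: measurable_cong_sets)
  define \<rho> where "\<rho> = density ?\<beta> (\<lambda>z. ennreal (p z))"
  have sets_\<rho>: "sets \<rho> = sets borel" using sets_\<beta> by (simp add: \<rho>_def)
  have em_rect: "emeasure \<rho> (X \<times> Y) = ennreal (\<Sum>i\<in>I. \<Sum>j\<in>J. w i j * (measure \<mu> (A i \<inter> X) * measure \<nu> (B j \<inter> Y)))"
    if X: "X \<in> sets borel" and Y: "Y \<in> sets borel" for X Y
  proof -
    have sets[measurable]: "A i \<inter> X \<in> sets \<mu>" "B j \<inter> Y \<in> sets \<nu>" for i j using A B X Y \<mu> \<nu> by auto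
    have "emeasure \<rho> (X \<times> Y) = (\<integral>\<^sup>+ z. ennreal (p z) * indicator (X \<times> Y) z \<partial>?\<beta>)"
      unfolding \<rho>_def using X Y \<mu> \<nu> by (intro emeasure_density) auto
    also have "\<dots> = (\<integral>\<^sup>+ z. (\<Sum>i\<in>I. \<Sum>j\<in>J. ennreal (w i j) * indicator ((A i \<inter> X) \<times> (B j \<inter> Y)) z) \<partial>?\<beta>)"
    proof (intro nn_integral_cong)
      fix z
      have "ennreal (p z) * indicator (X \<times> Y) z = ennreal (p z * indicator (X \<times> Y) z)"
        by (simp add: indicator_def)
      also have "p z * indicator (X \<times> Y) z = (\<Sum>i\<in>I. \<Sum>j\<in>J. w i j * indicator ((A i \<inter> X) \<times> (B j \<inter> Y)) z)"
        unfolding p_sum sum_distrib_right by (intro sum.cong refl) (auto simp: indicator_def)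
      also have "ennreal \<dots> = (\<Sum>i\<in>I. \<Sum>j\<in>J. ennreal (w i j * indicator ((A i \<inter> X) \<times> (B j \<inter> Y)) z))"
        by (simp add: w0 sum_nonneg flip: sum_ennreal)
      also have "\<dots> = (\<Sum>i\<in>I. \<Sum>j\<in>J. ennreal (w i j) * indicator ((A i \<inter> X) \<times> (B j \<inter> Y)) z)"
        by (intro sum.cong refl) (auto simp: indicator_def)
      finally show "ennreal (p z) * indicator (X \<times> Y) z = \<dots>" .
    qed
    also have "\<dots> = (\<Sum>i\<in>I. \<Sum>j\<in>J. ennreal (w i j) * (emeasure \<mu> (A i \<inter> X) * emeasure \<nu> (B j \<inter> Y)))"
      by (simp add: nn_integral_sum nn_integral_cmult \<nu>.emeasure_pair_measure_Times)
    also have "\<dots> = (\<Sum>i\<in>I. \<Sum>j\<in>J. ennreal (w i j * (measure \<mu> (A i \<inter> X) * measure \<nu> (B j \<inter> Y))))"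
      by (simp add: \<mu>.emeasure_eq_measure \<nu>.emeasure_eq_measure ennreal_mult w0)
    also have "\<dots> = ennreal (\<Sum>i\<in>I. \<Sum>j\<in>J. w i j * (measure \<mu> (A i \<inter> X) * measure \<nu> (B j \<inter> Y)))"
      by (simp add: w0 sum_nonneg flip: sum_ennreal)
    finally show ?thesis .
  qed
  have fst_marg: "emeasure \<rho> (X \<times> UNIV) = emeasure \<mu> X" if X: "X \<in> sets borel" for X
  proof -
    have "emeasure \<rho> (X \<times> UNIV) = ennreal (\<Sum>i\<in>I. \<Sum>j\<in>J. P i j / (m i * n j) * (measure \<mu> (A i \<inter> X) * n j))"
      using em_rect[OF X, of UNIV] by (simp add: w_def n_def)
    also have "(\<Sum>i\<in>I. \<Sum>j\<in>J. P i j / (m i * n j) * (measure \<mu> (A i \<inter> X) * n j)) = (\<Sum>i\<in>I. measure \<mu> (A i \<inter> X))"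
    proof (rule sum_block_weights[OF fin _ sum_m sum_n])
      show "measure \<mu> (A i \<inter> X) = 0" if "m i = 0" for i
        using \<mu>.finite_measure_mono[of "A i \<inter> X" "A i"] that A \<mu>(1) measure_nonneg[of \<mu> "A i \<inter> X"]
        by (auto simp: m_def intro: antisym)
    qed (simp add: P_def)
    also have "\<dots> = measure \<mu> (\<Union>i\<in>I. A i \<inter> X)"
      using A X \<mu>(1) fin by (intro \<mu>.finite_measure_finite_Union[symmetric]) (auto simp: disjoint_family_on_def A_def)
    also have "(\<Union>i\<in>I. A i \<inter> X) = X" using UA by blast
    finally show ?thesis by (simp add: \<mu>.emeasure_eq_measure)
  qed
  have snd_marg: "emeasure \<rho> (UNIV \<times> Y) = emeasure \<nu> Y" if Y: "Y \<in> sets borel" for Y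
  proof -
    have "emeasure \<rho> (UNIV \<times> Y) = ennreal (\<Sum>j\<in>J. \<Sum>i\<in>I. P i j / (n j * m i) * (measure \<nu> (B j \<inter> Y) * m i))"
      using em_rect[OF _ Y, of UNIV] by (subst sum.swap) (simp add: w_def m_def mult.commute)
    also have "(\<Sum>j\<in>J. \<Sum>i\<in>I. P i j / (n j * m i) * (measure \<nu> (B j \<inter> Y) * m i)) = (\<Sum>j\<in>J. measure \<nu> (B j \<inter> Y))"
    proof (rule sum_block_weights[OF fin(2,1) _ sum_n sum_m])
      show "measure \<nu> (B j \<inter> Y) = 0" if "n j = 0" for j
        using \<nu>.finite_measure_mono[of "B j \<inter> Y" "B j"] that B \<nu>(1) measure_nonneg[of \<nu> "B j \<inter> Y"]
        by (auto simp: n_def intro: antisym)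
    qed (simp add: P_def)
    also have "\<dots> = measure \<nu> (\<Union>j\<in>J. B j \<inter> Y)"
      using B Y \<nu>(1) fin by (intro \<nu>.finite_measure_finite_Union[symmetric]) (auto simp: disjoint_family_on_def B_def)
    also have "(\<Union>j\<in>J. B j \<inter> Y) = Y" using UB by blast
    finally show ?thesis by (simp add: \<nu>.emeasure_eq_measure)
  qed
  have prob_\<rho>: "prob_space \<rho>"
  proof (rule prob_spaceI)
    show "emeasure \<rho> (space \<rho>) = 1"
      using fst_marg[of UNIV] \<mu>.emeasure_space_1 space by (simp add: \<rho>_def)
  qed
  interpret \<rho>: prob_space \<rho> by (rule prob_\<rho>)
  have space_\<rho>: "space \<rho> = UNIV" using sets_eq_imp_space_eq[OF sets_\<rho>] by simp
  have [measurable_cong]: "sets \<rho> = sets (borel \<Otimes>\<^sub>M borel)" unfolding borel_prod by (rule sets_\<rho>)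
  have "\<rho> \<in> couplings \<mu> \<nu>"
    unfolding couplings_def
  proof (intro CollectI conjI sets_\<rho> prob_\<rho>)
    show "distr \<rho> borel fst = \<mu>"
    proof (rule measure_eqI)
      fix X assume "X \<in> sets (distr \<rho> borel fst)"
      then have X: "X \<in> sets borel" by simp
      then have "emeasure (distr \<rho> borel fst) X = emeasure \<rho> (fst -` X \<inter> space \<rho>)"
        by (intro emeasure_distr) auto
      also have "fst -` X \<inter> space \<rho> = X \<times> UNIV" using space_\<rho> by auto
      finally show "emeasure (distr \<rho> borel fst) X = emeasure \<mu> X" using fst_marg[OF X] by simp
    qed (simp add: \<mu>(1))
    show "distr \<rho> borel snd = \<nu>"
    proof (rule measure_eqI)
      fix Y assume "Y \<in> sets (distr \<rho> borel snd)"
      then have Y: "Y \<in> sets borel" by simp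
      then have "emeasure (distr \<rho> borel snd) Y = emeasure \<rho> (snd -` Y \<inter> space \<rho>)"
        by (intro emeasure_distr) auto
      also have "snd -` Y \<inter> space \<rho> = UNIV \<times> Y" using space_\<rho> by auto
      finally show "emeasure (distr \<rho> borel snd) Y = emeasure \<nu> Y" using snd_marg[OF Y] by simp
    qed (simp add: \<nu>(1))
  qed
  moreover have "D_KL \<rho> ?\<beta> < \<infinity>"
  proof -
    define C where "C = (\<Sum>i\<in>I. \<Sum>j\<in>J. kl_fun (w i j))"
    have "kl_fun (p z) \<le> C" for z
    proof -
      have "kl_fun (w (T (fst z)) (S (snd z))) \<le> (\<Sum>j\<in>J. kl_fun (w (T (fst z)) j))"
        using fin by (intro member_le_sum) (auto simp: J_def kl_fun_nonneg w0)
      also have "\<dots> \<le> C"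
        unfolding C_def using fin
        by (intro member_le_sum[where f = "\<lambda>i. \<Sum>j\<in>J. kl_fun (w i j)"]) (auto simp: I_def intro!: sum_nonneg kl_fun_nonneg w0)
      finally show ?thesis by (simp add: p_def)
    qed
    then have "(\<integral>\<^sup>+ z. ennreal (kl_fun (p z)) \<partial>?\<beta>) \<le> (\<integral>\<^sup>+ z. ennreal C \<partial>?\<beta>)"
      by (intro nn_integral_mono ennreal_leI)
    also have "\<dots> < \<infinity>" by (simp add: emeasure_space_1)
    finally have fin: "(\<integral>\<^sup>+ z. ennreal (kl_fun (p z)) \<partial>?\<beta>) < \<infinity>" .
    have "D_KL \<rho> ?\<beta> = enn2ereal (\<integral>\<^sup>+ z. ennreal (kl_fun (p z)) \<partial>?\<beta>)"
      by (rule D_KL_density[OF prob_space_axioms p p0 \<rho>_def prob_\<rho>])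
    then show ?thesis using fin
      by (cases "\<integral>\<^sup>+ z. ennreal (kl_fun (p z)) \<partial>?\<beta>") (auto simp: enn2ereal_ennreal)
  qed
  moreover have "(\<integral>z. g (T (fst z), S (snd z)) \<partial>\<rho>) = (\<integral>z. g (T (fst z), S (snd z)) \<partial>\<pi>)" for g :: "'c \<times> 'd \<Rightarrow> real"
  proof -
    have eq: "g (T (fst z), S (snd z)) = (\<Sum>i\<in>I. \<Sum>j\<in>J. g (i, j) * indicator (A i \<times> B j) z)" for z
    proof -
      have "(\<Sum>i\<in>I. \<Sum>j\<in>J. g (i, j) * indicator (A i \<times> B j) z)
          = (\<Sum>i\<in>I. if i = T (fst z) then (\<Sum>j\<in>J. if j = S (snd z) then g (i, j) else 0) else 0)"
        by (intro sum.cong refl) (auto simp: A_def B_def indicator_def mem_Times_iff intro!: sum.cong sum.neutral)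
      also have "\<dots> = g (T (fst z), S (snd z))" using fin by (simp add: I_def J_def)
      finally show ?thesis by simp
    qed
    have int: "(\<integral>z. g (T (fst z), S (snd z)) \<partial>K) = (\<Sum>i\<in>I. \<Sum>j\<in>J. g (i, j) * measure K (A i \<times> B j))"
      if K: "sets K = sets borel" "prob_space K" for K
    proof -
      interpret K: prob_space K by (rule K)
      have AB: "A i \<times> B j \<in> sets K" for i j using rect[OF A B] K(1) by simp
      then have "integrable K (\<lambda>z. g (i, j) * indicator (A i \<times> B j) z)" for i j
        by (intro integrable_mult_right integrable_real_indicator) (auto simp: K.emeasure_eq_measure)
      then show ?thesis
        unfolding eq using AB by (simp add: Bochner_Integration.integral_sum Bochner_Integration.integrable_sum)
    qed
    have "measure \<rho> (A i \<times> B j) = P i j" if ij: "i \<in> I" "j \<in> J" for i j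
    proof -
      have "(\<Sum>i'\<in>I. \<Sum>j'\<in>J. w i' j' * (measure \<mu> (A i' \<inter> A i) * measure \<nu> (B j' \<inter> B j)))
          = (\<Sum>i'\<in>I. if i' = i then (\<Sum>j'\<in>J. if j' = j then w i' j' * (m i' * n j') else 0) else 0)"
      proof (intro sum.cong refl)
        fix i' assume "i' \<in> I"
        have 1: "measure \<mu> (A i' \<inter> A i) = (if i' = i then m i' else 0)"
        proof -
          have "A i' \<inter> A i = (if i' = i then A i else {})" by (auto simp: A_def)
          then show ?thesis by (simp add: m_def)
        qed
        have 2: "measure \<nu> (B j' \<inter> B j) = (if j' = j then n j' else 0)" for j'
        proof -
          have "B j' \<inter> B j = (if j' = j then B j else {})" by (auto simp: B_def)
          then show ?thesis by (simp add: n_def)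
        qed
        show "(\<Sum>j'\<in>J. w i' j' * (measure \<mu> (A i' \<inter> A i) * measure \<nu> (B j' \<inter> B j)))
            = (if i' = i then (\<Sum>j'\<in>J. if j' = j then w i' j' * (m i' * n j') else 0) else 0)"
          unfolding 1 2 by (auto intro!: sum.cong)
      qed
      also have "\<dots> = w i j * (m i * n j)" using fin ij by simp
      also have "\<dots> = P i j"
      proof -
        have "P i j = 0" if "m i = 0 \<or> n j = 0"
          using that sum_m[of i] sum_n[of j] fin ij
          by (auto simp: P_def sum_nonneg_eq_0_iff)
        then show ?thesis by (auto simp: w_def)
      qed
      finally have "emeasure \<rho> (A i \<times> B j) = ennreal (P i j)" using em_rect[OF A B, of i j] by simp
      then show ?thesis by (simp add: \<rho>.emeasure_eq_measure P_def)
    qed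
    then show ?thesis
      unfolding int[OF sets_\<rho> prob_\<rho>] int[OF c(1,2)] by (simp add: P_def)
  qed
  ultimately show ?thesis by blast
qed

text \<open>
  Block couplings along simple functions \<open>T\<^sub>k\<close>, \<open>S\<^sub>k\<close> that converge to the identity.  The law of
  \<open>(T\<^sub>k, S\<^sub>k)\<close> is the same under \<open>\<rho>\<^sub>k\<close> and under \<open>\<pi>\<close>, and the error of replacing a point by its image
  under \<open>(T\<^sub>k, S\<^sub>k)\<close> is controlled by the marginals alone, hence uniformly in the coupling.
\<close>

lemma finite_D_KL_dense:
  fixes \<mu> :: "'a::euclidean_space measure" and \<nu> :: "'b::euclidean_space measure"
  assumes P4: "\<mu> \<in> P4" "\<nu> \<in> P4" and \<pi>: "\<pi> \<in> couplings \<mu> \<nu>"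
  obtains \<rho> where "\<And>k::nat. \<rho> k \<in> couplings \<mu> \<nu>" "\<And>k. D_KL (\<rho> k) (\<mu> \<Otimes>\<^sub>M \<nu>) < \<infinity>"
    "(\<lambda>k. gw_distortion (\<rho> k)) \<longlonglongrightarrow> gw_distortion \<pi>"
proof -
  have \<mu>: "sets \<mu> = sets borel" "prob_space \<mu>" and \<nu>: "sets \<nu> = sets borel" "prob_space \<nu>"
    using P4 by (auto simp: P4_def)
  note c = couplingsD[OF \<pi>]
  have "\<exists>T. (\<forall>k. simple_function borel (T k)) \<and> (\<forall>x::'a. (\<lambda>k. T k x) \<longlonglongrightarrow> x)"
    using borel_measurable_implies_sequence_metric[of "\<lambda>x::'a. x" borel 0] by auto
  then obtain T :: "nat \<Rightarrow> 'a \<Rightarrow> 'a"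
    where T: "\<And>k. simple_function borel (T k)" "\<And>x. (\<lambda>k. T k x) \<longlonglongrightarrow> x" by blast
  have "\<exists>S. (\<forall>k. simple_function borel (S k)) \<and> (\<forall>y::'b. (\<lambda>k. S k y) \<longlonglongrightarrow> y)"
    using borel_measurable_implies_sequence_metric[of "\<lambda>y::'b. y" borel 0] by auto
  then obtain S :: "nat \<Rightarrow> 'b \<Rightarrow> 'b"
    where S: "\<And>k. simple_function borel (S k)" "\<And>y. (\<lambda>k. S k y) \<longlonglongrightarrow> y" by blast
  have "\<exists>\<rho>. \<forall>k. \<rho> k \<in> couplings \<mu> \<nu> \<and> D_KL (\<rho> k) (\<mu> \<Otimes>\<^sub>M \<nu>) < \<infinity> \<and>
      (\<forall>g :: 'a \<times> 'b \<Rightarrow> real. (\<integral>z. g (T k (fst z), S k (snd z)) \<partial>\<rho> k) = (\<integral>z. g (T k (fst z), S k (snd z)) \<partial>\<pi>))"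
    using block_coupling[OF \<mu> \<nu> \<pi> T(1) S(1)] by (intro choice allI) (simp only: Bex_def)
  then obtain \<rho> where \<rho>: "\<And>k. \<rho> k \<in> couplings \<mu> \<nu>" "\<And>k. D_KL (\<rho> k) (\<mu> \<Otimes>\<^sub>M \<nu>) < \<infinity>"
    and same: "\<And>k (g :: 'a \<times> 'b \<Rightarrow> real). (\<integral>z. g (T k (fst z), S k (snd z)) \<partial>\<rho> k) = (\<integral>z. g (T k (fst z), S k (snd z)) \<partial>\<pi>)"
    by blast
  note c\<rho> = couplingsD[OF \<rho>(1)]
  have Tm[measurable]: "T k \<in> borel_measurable borel" and Sm[measurable]: "S k \<in> borel_measurable borel" for k
    using T(1) S(1) by (auto intro: borel_measurable_simple_function)
  have conv: "(\<lambda>k. \<integral>z. f z \<partial>\<rho> k) \<longlonglongrightarrow> (\<integral>z. f z \<partial>\<pi>)"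
    if lip: "\<exists>L. L-lipschitz_on UNIV f" and f01: "\<And>z. 0 \<le> f z \<and> f z \<le> 1" for f :: "'a \<times> 'b \<Rightarrow> real"
  proof -
    obtain L where L: "L-lipschitz_on UNIV f" using lip by blast
    then have L0: "0 \<le> L" by (rule lipschitz_on_nonneg)
    have contf: "continuous_on UNIV f" using L by (rule lipschitz_on_continuous_on)
    then have fm: "f \<in> borel_measurable (borel \<Otimes>\<^sub>M borel)"
      unfolding borel_prod by (rule borel_measurable_continuous_onI)
    let ?TS = "\<lambda>k z. (T k (fst z), S k (snd z))"
    have cong: "measurable K = measurable (borel \<Otimes>\<^sub>M borel)" if "sets K = sets borel" for K :: "('a \<times> 'b) measure"
      using that unfolding borel_prod[symmetric] by (intro ext measurable_cong_sets) auto
    have fm': "f \<in> borel_measurable K" "(\<lambda>z. f (?TS k z)) \<in> borel_measurable K" if "sets K = sets borel" for K k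
      unfolding cong[OF that] using fm by measurable
    define u where "u k x = min 1 (L * dist x (T k x))" for k x
    define v where "v k y = min 1 (L * dist y (S k y))" for k y
    have um[measurable]: "u k \<in> borel_measurable borel" and vm[measurable]: "v k \<in> borel_measurable borel" for k
      unfolding u_def v_def by measurable
    have u01: "0 \<le> u k x" "u k x \<le> 1" and v01: "0 \<le> v k y" "v k y \<le> 1" for k x y
      using L0 by (auto simp: u_def v_def)
    have u_lim: "(\<lambda>k. u k x) \<longlonglongrightarrow> 0" for x
    proof -
      have "(\<lambda>k. min 1 (L * dist x (T k x))) \<longlonglongrightarrow> min 1 (L * dist x x)"
        by (intro tendsto_intros T(2))
      then show ?thesis by (simp add: u_def)
    qed
    have v_lim: "(\<lambda>k. v k y) \<longlonglongrightarrow> 0" for y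
    proof -
      have "(\<lambda>k. min 1 (L * dist y (S k y))) \<longlonglongrightarrow> min 1 (L * dist y y)"
        by (intro tendsto_intros S(2))
      then show ?thesis by (simp add: v_def)
    qed
    have U: "(\<lambda>k. \<integral>x. u k x \<partial>\<mu>) \<longlonglongrightarrow> 0"
    proof -
      interpret prob_space \<mu> by (rule \<mu>)
      have "u k \<in> borel_measurable \<mu>" for k using um \<mu>(1) by (simp cong: measurable_cong_sets)
      then have "(\<lambda>k. \<integral>x. u k x \<partial>\<mu>) \<longlonglongrightarrow> (\<integral>x. 0 \<partial>\<mu>)"
        using u01 u_lim by (intro integral_dominated_convergence[where w = "\<lambda>_. 1"]) auto
      then show ?thesis by simp
    qed
    have V: "(\<lambda>k. \<integral>y. v k y \<partial>\<nu>) \<longlonglongrightarrow> 0"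
    proof -
      interpret prob_space \<nu> by (rule \<nu>)
      have "v k \<in> borel_measurable \<nu>" for k using vm \<nu>(1) by (simp cong: measurable_cong_sets)
      then have "(\<lambda>k. \<integral>y. v k y \<partial>\<nu>) \<longlonglongrightarrow> (\<integral>y. 0 \<partial>\<nu>)"
        using v01 v_lim by (intro integral_dominated_convergence[where w = "\<lambda>_. 1"]) auto
      then show ?thesis by simp
    qed
    have diff: "\<bar>(\<integral>z. f z \<partial>\<rho> k) - (\<integral>z. f (?TS k z) \<partial>\<pi>)\<bar> \<le> (\<integral>x. u k x \<partial>\<mu>) + (\<integral>y. v k y \<partial>\<nu>)" for k
    proof -
      interpret prob_space "\<rho> k" by (rule c\<rho>)
      note c\<rho>(5,6)[of k, measurable]
      have fi: "integrable (\<rho> k) f" "integrable (\<rho> k) (\<lambda>z. f (?TS k z))"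
        using fm'[OF c\<rho>(1)] f01 by (auto intro!: integrable_const_bound[where B = 1])
      have ui: "integrable (\<rho> k) (\<lambda>z. u k (fst z))" and vi: "integrable (\<rho> k) (\<lambda>z. v k (snd z))"
        using u01 v01 by (auto intro!: integrable_const_bound[where B = 1])
      have pt: "\<bar>f z - f (?TS k z)\<bar> \<le> u k (fst z) + v k (snd z)" for z
      proof -
        have "\<bar>f z - f (?TS k z)\<bar> \<le> L * dist z (?TS k z)"
          using lipschitz_onD[OF L, of z "?TS k z"] by (simp add: dist_real_def)
        also have "dist z (?TS k z) \<le> dist (fst z) (T k (fst z)) + dist (snd z) (S k (snd z))"
          using norm_Pair_le[of "fst z - T k (fst z)" "snd z - S k (snd z)"]
          by (cases z) (simp add: dist_norm)
        finally have "\<bar>f z - f (?TS k z)\<bar> \<le> L * dist (fst z) (T k (fst z)) + L * dist (snd z) (S k (snd z))"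
          using L0 by (simp add: mult_left_mono distrib_left)
        moreover have "\<bar>f z - f (?TS k z)\<bar> \<le> 1" using f01[of z] f01[of "?TS k z"] by linarith
        moreover have "0 \<le> L * dist (fst z) (T k (fst z))" "0 \<le> L * dist (snd z) (S k (snd z))" using L0 by auto
        ultimately show ?thesis by (simp add: u_def v_def min_def)
      qed
      have "\<bar>(\<integral>z. f z \<partial>\<rho> k) - (\<integral>z. f (?TS k z) \<partial>\<rho> k)\<bar> = \<bar>\<integral>z. f z - f (?TS k z) \<partial>\<rho> k\<bar>"
        using fi by (simp add: Bochner_Integration.integral_diff)
      also have "\<dots> \<le> (\<integral>z. \<bar>f z - f (?TS k z)\<bar> \<partial>\<rho> k)" by (rule integral_abs_bound)
      also have "\<dots> \<le> (\<integral>z. u k (fst z) + v k (snd z) \<partial>\<rho> k)"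
        using fi ui vi pt by (intro integral_mono) auto
      also have "\<dots> = (\<integral>z. u k (fst z) \<partial>\<rho> k) + (\<integral>z. v k (snd z) \<partial>\<rho> k)"
        using ui vi by (rule Bochner_Integration.integral_add)
      also have "(\<integral>z. u k (fst z) \<partial>\<rho> k) = (\<integral>x. u k x \<partial>\<mu>)"
        unfolding c\<rho>(3)[of k, symmetric] by (rule integral_distr[symmetric]) measurable
      also have "(\<integral>z. v k (snd z) \<partial>\<rho> k) = (\<integral>y. v k y \<partial>\<nu>)"
        unfolding c\<rho>(4)[of k, symmetric] by (rule integral_distr[symmetric]) measurable
      finally show ?thesis using same[of k f] by simp
    qed
    have lim_\<pi>: "(\<lambda>k. \<integral>z. f (?TS k z) \<partial>\<pi>) \<longlonglongrightarrow> (\<integral>z. f z \<partial>\<pi>)"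
    proof (rule integral_dominated_convergence[where w = "\<lambda>_. 1"])
      interpret prob_space \<pi> by (rule c)
      show "integrable \<pi> (\<lambda>_. 1 :: real)" by simp
      show "AE z in \<pi>. (\<lambda>k. f (?TS k z)) \<longlonglongrightarrow> f z"
      proof (rule AE_I2)
        fix z
        have "(\<lambda>k. ?TS k z) \<longlonglongrightarrow> (fst z, snd z)" by (intro tendsto_intros T(2) S(2))
        from continuous_on_tendsto_compose[OF contf this] show "(\<lambda>k. f (?TS k z)) \<longlonglongrightarrow> f z" by simp
      qed
    qed (use fm'[OF c(1)] f01 in auto)
    have "(\<lambda>k. (\<integral>z. f z \<partial>\<rho> k) - (\<integral>z. f (?TS k z) \<partial>\<pi>)) \<longlonglongrightarrow> 0"
    proof (rule Lim_null_comparison)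
      show "(\<lambda>k. (\<integral>x. u k x \<partial>\<mu>) + (\<integral>y. v k y \<partial>\<nu>)) \<longlonglongrightarrow> 0"
        using tendsto_add[OF U V] by simp
      show "\<forall>\<^sub>F k in sequentially. norm ((\<integral>z. f z \<partial>\<rho> k) - (\<integral>z. f (?TS k z) \<partial>\<pi>))
          \<le> (\<integral>x. u k x \<partial>\<mu>) + (\<integral>y. v k y \<partial>\<nu>)"
        unfolding real_norm_def by (intro always_eventually allI diff)
    qed
    from tendsto_add[OF this lim_\<pi>] show ?thesis by simp
  qed
  have "\<exists>R. \<forall>k. 1 - e < measure (\<rho> k) (cball 0 R)" if "e > 0" for e
    using couplings_tight[OF \<mu> \<nu> that] \<rho>(1) by meson
  from tight_imp_convergent_representation[of \<rho>, OF c\<rho>(1,2) this]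
  obtain r \<Omega> X X' where r: "strict_mono (r :: nat \<Rightarrow> nat)" and \<Omega>: "prob_space (\<Omega> :: real measure)"
    and X: "\<And>k. X k \<in> borel_measurable \<Omega>" "\<And>k. distr \<Omega> borel (X k) = \<rho> (r k)" "X' \<in> borel_measurable \<Omega>"
    and lim: "\<And>\<omega>. \<omega> \<in> space \<Omega> \<Longrightarrow> (\<lambda>k. X k \<omega>) \<longlonglongrightarrow> X' \<omega>"
    by blast
  have "distr \<Omega> borel X' = \<pi>"
  proof (rule distr_limit_eq[OF _ X(1,3) lim c(1)])
    show "finite_measure \<Omega>" "finite_measure \<pi>" using \<Omega> c(2) by (auto intro: prob_space.finite_measure)
    show "(\<lambda>k. \<integral>x. f x \<partial>distr \<Omega> borel (X k)) \<longlonglongrightarrow> (\<integral>x. f x \<partial>\<pi>)"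
      if "\<exists>L. L-lipschitz_on UNIV f" "\<And>x. 0 \<le> f x \<and> f x \<le> 1" for f :: "'a \<times> 'b \<Rightarrow> real"
      using LIMSEQ_subseq_LIMSEQ[OF conv[OF that] r] by (simp add: X(2) comp_def)
  qed
  moreover have "(\<lambda>k. gw_distortion (distr \<Omega> borel (X k))) \<longlonglongrightarrow> gw_distortion (distr \<Omega> borel X')"
    by (rule gw_distortion_limit(2)[OF P4 \<Omega> X(1,3) _ lim]) (simp add: X(2) \<rho>(1))
  ultimately have "(\<lambda>k. gw_distortion (\<rho> (r k))) \<longlonglongrightarrow> gw_distortion \<pi>" by (simp add: X(2))
  then show ?thesis using that[of "\<lambda>k. \<rho> (r k)"] \<rho> by blast
qed

section \<open>Optimality of the limit\<close>

text \<open>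
  The variational part of the argument, for a sequence of optimal couplings that already converges.
\<close>

theorem optimal_coupling_of_limit:
  fixes \<mu> :: "'a::euclidean_space measure" and \<nu> :: "'b::euclidean_space measure"
  assumes P4: "\<mu> \<in> P4" "\<nu> \<in> P4"
    and \<epsilon>s: "\<And>k. \<epsilon>s k > 0" "\<And>k. \<epsilon> \<le> \<epsilon>s k" "\<epsilon>s \<longlonglongrightarrow> \<epsilon>" and \<epsilon>: "\<epsilon> \<ge> 0"
    and opt: "\<And>k. optimal_coupling (\<epsilon>s k) \<mu> \<nu> (\<pi>s k)"
    and \<pi>: "\<pi> \<in> couplings \<mu> \<nu>" and conv: "weakly_converges \<pi>s \<pi>"
    and gw: "(\<lambda>k. gw_distortion (\<pi>s k)) \<longlonglongrightarrow> gw_distortion \<pi>"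
  shows "optimal_coupling \<epsilon> \<mu> \<nu> \<pi>"
proof -
  let ?\<beta> = "\<mu> \<Otimes>\<^sub>M \<nu>"
  have \<mu>: "sets \<mu> = sets borel" "prob_space \<mu>" and \<nu>: "sets \<nu> = sets borel" "prob_space \<nu>"
    using P4 by (auto simp: P4_def)
  have sets_\<beta>: "sets ?\<beta> = sets borel"
    using sets_pair_measure_cong[OF \<mu>(1) \<nu>(1)] unfolding borel_prod .
  have prob_\<beta>: "prob_space ?\<beta>" using \<mu>(2) \<nu>(2) by (rule prob_space_pair)
  have \<pi>s: "\<pi>s k \<in> couplings \<mu> \<nu>" for k using opt[of k] by (simp add: optimal_coupling_def)
  note c = couplingsD[OF \<pi>] and cs = couplingsD[OF \<pi>s]
  have KL0: "0 \<le> D_KL \<rho> ?\<beta>" if "\<rho> \<in> couplings \<mu> \<nu>" for \<rho>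
    using couplingsD(1,2)[OF that] sets_\<beta> by (intro D_KL_nonneg[OF prob_\<beta>]) auto
  define d where "d \<rho> = enn2real (gw_distortion \<rho>)" for \<rho> :: "('a \<times> 'b) measure"
  have d: "gw_distortion \<rho> = ennreal (d \<rho>)" if "\<rho> \<in> couplings \<mu> \<nu>" for \<rho>
    using gw_distortion_finite[OF P4 that] by (simp add: d_def)
  have d0: "0 \<le> d \<rho>" for \<rho> by (simp add: d_def)
  have d_lim: "(\<lambda>k. d (\<pi>s k)) \<longlonglongrightarrow> d \<pi>"
    unfolding d_def using gw gw_distortion_finite[OF P4 \<pi>] by (intro tendsto_enn2real) (auto simp: less_top)
  have le_finite: "S_objective \<epsilon> \<mu> \<nu> \<pi> \<le> S_objective \<epsilon> \<mu> \<nu> \<rho>"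
    if \<rho>: "\<rho> \<in> couplings \<mu> \<nu>" and fin: "D_KL \<rho> ?\<beta> < \<infinity>" for \<rho>
  proof -
    obtain K where K: "D_KL \<rho> ?\<beta> = ereal K" "0 \<le> K"
      using KL0[OF \<rho>] fin by (cases "D_KL \<rho> ?\<beta>") auto
    have "\<exists>\<kappa>. D_KL (\<pi>s k) ?\<beta> = ereal \<kappa> \<and> 0 \<le> \<kappa> \<and> d (\<pi>s k) + \<epsilon>s k * \<kappa> \<le> d \<rho> + \<epsilon>s k * K" for k
    proof -
      have "S_objective (\<epsilon>s k) \<mu> \<nu> (\<pi>s k) \<le> S_objective (\<epsilon>s k) \<mu> \<nu> \<rho>"
        using opt[of k] \<rho> by (auto simp: optimal_coupling_def S_def intro: INF_lower)
      then have le: "ereal (d (\<pi>s k)) + ereal (\<epsilon>s k) * D_KL (\<pi>s k) ?\<beta> \<le> ereal (d \<rho> + \<epsilon>s k * K)"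
        using \<epsilon>s(1)[of k] by (simp add: S_objective_def d[OF \<pi>s] d[OF \<rho>] d0 enn2ereal_ennreal K)
      then show ?thesis
        using KL0[OF \<pi>s[of k]] \<epsilon>s(1)[of k] by (cases "D_KL (\<pi>s k) ?\<beta>") auto
    qed
    then obtain \<kappa> where \<kappa>: "\<And>k. D_KL (\<pi>s k) ?\<beta> = ereal (\<kappa> k)" "\<And>k. 0 \<le> \<kappa> k"
      "\<And>k. d (\<pi>s k) + \<epsilon>s k * \<kappa> k \<le> d \<rho> + \<epsilon>s k * K" by metis
    have \<kappa>_le: "\<epsilon> * \<kappa> k \<le> d \<rho> + \<epsilon>s k * K - d (\<pi>s k)" for k
      using \<kappa>(3)[of k] mult_right_mono[OF \<epsilon>s(2) \<kappa>(2), of k k] by linarith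
    have lim: "(\<lambda>k. d \<rho> + \<epsilon>s k * K - d (\<pi>s k)) \<longlonglongrightarrow> d \<rho> + \<epsilon> * K - d \<pi>"
      by (intro tendsto_intros \<epsilon>s(3) d_lim)
    show ?thesis
    proof (cases "\<epsilon> = 0")
      case True
      then have "0 \<le> d \<rho> + \<epsilon>s k * K - d (\<pi>s k)" for k using \<kappa>_le[of k] by simp
      then have "0 \<le> d \<rho> + \<epsilon> * K - d \<pi>" by (intro LIMSEQ_le_const[OF lim]) auto
      then show ?thesis using True by (simp add: S_objective_def d[OF \<pi>] d[OF \<rho>] d0 enn2ereal_ennreal)
    next
      case False
      with \<epsilon> have pos: "\<epsilon> > 0" by simp
      define l where "l = (d \<rho> + \<epsilon> * K - d \<pi>) / \<epsilon>"
      \<comment> \<open>l is the limit of the upper bounds on the divergences of the optimal couplings\<close>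
      have "D_KL \<pi> ?\<beta> \<le> ereal (l + \<delta>)" if \<delta>: "\<delta> > 0" for \<delta>
      proof -
        have "(\<lambda>k. (d \<rho> + \<epsilon>s k * K - d (\<pi>s k)) / \<epsilon>) \<longlonglongrightarrow> l"
          unfolding l_def by (intro tendsto_divide lim tendsto_const) (use pos in simp)
        then have ev: "\<forall>\<^sub>F k in sequentially. (d \<rho> + \<epsilon>s k * K - d (\<pi>s k)) / \<epsilon> < l + \<delta>"
          by (rule order_tendstoD) (use \<delta> in simp)
        have \<kappa>_div: "\<kappa> k \<le> (d \<rho> + \<epsilon>s k * K - d (\<pi>s k)) / \<epsilon>" for k
          using \<kappa>_le[of k] pos by (simp add: field_simps)
        then have ev': "\<forall>\<^sub>F k in sequentially. \<kappa> k \<le> l + \<delta>"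
          using ev by (auto elim!: eventually_mono intro: order_trans less_imp_le)
        then obtain k where "\<kappa> k \<le> l + \<delta>" using eventually_happens'[OF sequentially_bot] by blast
        then have "0 \<le> l + \<delta>" using \<kappa>(2)[of k] by linarith
        then show ?thesis
          using ev' by (intro D_KL_weak_limit_le[OF sets_\<beta> prob_\<beta> c(1,2) cs(1,2) conv]) (simp_all add: \<kappa>(1))
      qed
      then have "D_KL \<pi> ?\<beta> \<le> ereal l"
        by - (rule ereal_le_epsilon2, simp)
      then obtain \<kappa>' where \<kappa>': "D_KL \<pi> ?\<beta> = ereal \<kappa>'" "\<kappa>' \<le> l"
        using KL0[OF \<pi>] by (cases "D_KL \<pi> ?\<beta>") auto
      then have "d \<pi> + \<epsilon> * \<kappa>' \<le> d \<rho> + \<epsilon> * K"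
        using pos by (simp add: l_def field_simps)
      then show ?thesis
        using False by (simp add: S_objective_def d[OF \<pi>] d[OF \<rho>] d0 enn2ereal_ennreal K \<kappa>')
    qed
  qed
  have "S_objective \<epsilon> \<mu> \<nu> \<pi> \<le> S_objective \<epsilon> \<mu> \<nu> \<rho>" if \<rho>: "\<rho> \<in> couplings \<mu> \<nu>" for \<rho>
  proof (cases "D_KL \<rho> ?\<beta> < \<infinity>")
    case True then show ?thesis by (rule le_finite[OF \<rho>])
  next
    case False
    show ?thesis
    proof (cases "\<epsilon> = 0")
      case True
      obtain \<rho>s where \<rho>s: "\<And>k::nat. \<rho>s k \<in> couplings \<mu> \<nu>" "\<And>k. D_KL (\<rho>s k) ?\<beta> < \<infinity>"
        "(\<lambda>k. gw_distortion (\<rho>s k)) \<longlonglongrightarrow> gw_distortion \<rho>"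
        using finite_D_KL_dense[OF P4 \<rho>] by blast
      have "gw_distortion \<pi> \<le> gw_distortion (\<rho>s k)" for k
        using le_finite[OF \<rho>s(1,2)[of k]] True by (simp add: S_objective_def less_eq_ennreal.rep_eq)
      then have "gw_distortion \<pi> \<le> gw_distortion \<rho>" by (intro LIMSEQ_le_const[OF \<rho>s(3)]) auto
      then show ?thesis using True by (simp add: S_objective_def less_eq_ennreal.rep_eq)
    next
      case False': False
      have "D_KL \<rho> ?\<beta> = \<infinity>" using False by simp
      then have "S_objective \<epsilon> \<mu> \<nu> \<rho> = \<infinity>"
        using False' \<epsilon> by (simp add: S_objective_def d[OF \<rho>] d0 enn2ereal_ennreal)
      then show ?thesis by simp
    qed
  qed
  then show ?thesis
    using \<pi> unfolding optimal_coupling_def S_def by (auto intro!: antisym INF_greatest INF_lower)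
qed

theorem proposition2:
  fixes \<mu> :: "(real ^ 'dx) measure"
    and \<nu> :: "(real ^ 'dy) measure"
    and \<epsilon>s :: "nat \<Rightarrow> real"
    and \<epsilon> :: real
    and \<pi>s :: "nat \<Rightarrow> ((real ^ 'dx) \<times> (real ^ 'dy)) measure"
  assumes "\<mu> \<in> P4"
    and "\<nu> \<in> P4"
    and "\<And>k. \<epsilon>s k > 0"
    and "decseq \<epsilon>s"
    and "\<epsilon>s \<longlonglongrightarrow> \<epsilon>"
    and "\<epsilon> \<ge> 0"
    and "\<And>k. optimal_coupling (\<epsilon>s k) \<mu> \<nu> (\<pi>s k)"
  shows "\<exists>\<pi>\<in>couplings \<mu> \<nu>.
    (\<exists>r :: nat \<Rightarrow> nat. strict_mono r \<and> weakly_converges (\<lambda>k. \<pi>s (r k)) \<pi>) \<and>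
    optimal_coupling \<epsilon> \<mu> \<nu> \<pi>"
proof -
  have \<mu>: "sets \<mu> = sets borel" "prob_space \<mu>" and \<nu>: "sets \<nu> = sets borel" "prob_space \<nu>"
    using assms(1,2) by (auto simp: P4_def)
  have \<pi>s: "\<pi>s k \<in> couplings \<mu> \<nu>" for k using assms(7)[of k] by (simp add: optimal_coupling_def)
  have "\<exists>R. \<forall>k. 1 - e < measure (\<pi>s k) (cball 0 R)" if "e > 0" for e
    using couplings_tight[OF \<mu> \<nu> that] \<pi>s by meson
  from tight_imp_convergent_representation[of \<pi>s, OF couplingsD(1,2)[OF \<pi>s] this]
  obtain r \<Omega> X X' where r: "strict_mono (r :: nat \<Rightarrow> nat)" and \<Omega>: "prob_space (\<Omega> :: real measure)"
    and X: "\<And>k. X k \<in> borel_measurable \<Omega>" "\<And>k. distr \<Omega> borel (X k) = \<pi>s (r k)" "X' \<in> borel_measurable \<Omega>"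
    and lim: "\<And>\<omega>. \<omega> \<in> space \<Omega> \<Longrightarrow> (\<lambda>k. X k \<omega>) \<longlonglongrightarrow> X' \<omega>"
    by blast
  define \<pi> where "\<pi> = distr \<Omega> borel X'"
  have conv: "weakly_converges (\<lambda>k. \<pi>s (r k)) \<pi>"
    using weakly_converges_distr[OF prob_space.finite_measure[OF \<Omega>] X(1,3) lim] by (simp add: X(2) \<pi>_def)
  have "distr \<Omega> borel (X k) \<in> couplings \<mu> \<nu>" for k by (simp add: X(2) \<pi>s)
  note gw = gw_distortion_limit[OF assms(1,2) \<Omega> X(1,3) this lim, folded \<pi>_def, unfolded X(2)]
  have "optimal_coupling \<epsilon> \<mu> \<nu> \<pi>"
  proof (rule optimal_coupling_of_limit[OF assms(1,2) _ _ _ assms(6) _ gw(1) conv gw(2)])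
    show "\<epsilon> \<le> \<epsilon>s (r k)" for k using decseq_ge[OF assms(4,5)] .
    show "(\<lambda>k. \<epsilon>s (r k)) \<longlonglongrightarrow> \<epsilon>" using LIMSEQ_subseq_LIMSEQ[OF assms(5) r] by (simp add: comp_def)
  qed (use assms in auto)
  then show ?thesis using gw(1) r conv by blast
qed

end
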